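(* Let $\mathcal{B}$ be an exact category, and let $\mathcal{A}$ and $\mathcal{C}$ be exact subcategories of $\mathcal{B}$ (full subcategories closed under extensions in $\mathcal{B}$). Let $\mathcal{E}(\mathcal{A},\mathcal{B},\mathcal{C})$ be the associated extension category. Then $$K_{n}\mathcal{E}(\mathcal{A},\mathcal{B},\mathcal{C}) \cong K_{n}\mathcal{A} \times K_{n}\mathcal{C}$$ for every $n \geq 0$.
   Context: Exact categories are in the sense of Quillen: additive categories with a distinguished class of short exact sequences $N' \rightarrowtail N \twoheadrightarrow N''$ satisfying Quillen's axioms. An exact subcategory of an exact category $\mathcal{N}$ is a full (additive) subcategory closed under extensions in $\mathcal{N}$; its short exact sequences are those of $\mathcal{N}$ with all terms in the subcategory. Extension category: $\mathcal{E}(\mathcal{A},\mathcal{B},\mathcal{C})$ has as objects the short exact sequences $A \rightarrowtail B \twoheadrightarrow C$ of $\mathcal{B}$ with $A$ in $\mathcal{A}$ and $C$ in $\mathcal{C}$; its morphisms are commuting diagrams between such sequences. It is an exact category, a composable pair of morphisms being short exact when it is short exact term-wise (in $\mathcal{A}$, $\mathcal{B}$ and $\mathcal{C}$). Acyclic complexes: a bounded chain complex $(N,d)$ in an exact category $\mathcal{N}$ is acyclic if each differential $d_k : N_k \to N_{k-1}$ factors as $N_k \twoheadrightarrow Z_{k-1} \rightarrowtail N_{k-1}$ such that each $Z_k \rightarrowtail N_k \twoheadrightarrow Z_{k-1}$ is a short exact sequence of $\mathcal{N}$. Acyclic binary complexes: a bounded acyclic binary complex in $\mathcal{N}$ is a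 triple $(N,d,\tilde d)$ such that $(N,d)$ and $(N,\tilde d)$ are both bounded acyclic complexes in $\mathcal{N}$ on the same graded object. Morphisms are morphisms of graded objects commuting with both differentials, and a composable pair of morphisms is short exact if it is short exact term-wise in $\mathcal{N}$. This gives an exact category $B^{\mathrm{q}}\mathcal{N}$. Put $(B^{\mathrm{q}})^{0}\mathcal{N}=\mathcal{N}$ and $(B^{\mathrm{q}})^{n}\mathcal{N} = B^{\mathrm{q}}\cdots B^{\mathrm{q}}\mathcal{N}$ ($n$ times). Equivalently, an object of $(B^{\mathrm{q}})^{n}\mathcal{N}$ (a bounded acyclic binary multicomplex of dimension $n$) is a bounded $\mathbb{Z}^n$-graded collection of objects of $\mathcal{N}$ with a pair of acyclic differentials $d^i,\tilde d^i$ in each direction $1\le i\le n$, such that any two differentials in different directions commute. An object of $(B^{\mathrm{q}})^{n}\mathcal{N}$ is diagonal in direction $i$ if $d^i=\tilde d^i$, and diagonal if it is diagonal in at least one direction $i$. $K$-groups: for $n\ge 0$, $K_n\mathcal{N}$ is defined as the abelian group with one generator $[N]$ for each object $N$ of $(B^{\mathrm{q}})^{n}\mathcal{N}$, and relations $[N']+[N'']=[N]$ for each short exact sequence $N'\rightarrowtail N\twoheadrightarrow N''$ in $(B^{\mathrm{q}})^{n}\mathcal{N}$, and $[T]=0$ for each diagonal object $T$. For $n=0$ there are no diagonal objects and $K_0\mathcal{N}$ is the Grothendieck group. *)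

theory Defs
  imports "HOL-Algebra.Free_Abelian_Groups"
begin

section \<open>Exact categories\<close>

text \<open>
  The data of a small category with enriched Hom sets and a distinguished class of
  sequences. A member (i, p) of SES stands for the short exact sequence
  Dom i >-> Cod i = Dom p ->> Cod p. All operations are meaningful on Obj and Arr only;
  Zero X Y is the zero morphism from X to Y.
\<close>

record ('o, 'm) exact_data =
  Obj  :: "'o set"
  Arr  :: "'m set"
  Dom  :: "'m \<Rightarrow> 'o"
  Cod  :: "'m \<Rightarrow> 'o"
  Ide  :: "'o \<Rightarrow> 'm"
  Comp :: "'m \<Rightarrow> 'm \<Rightarrow> 'm"  (infixl \<open>\<cdot>\<index>\<close> 70)
  Zero :: "'o \<Rightarrow> 'o \<Rightarrow> 'm"
  Add  :: "'m \<Rightarrow> 'm \<Rightarrow> 'm"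
  SES  :: "('m \<times> 'm) set"

definition Hom :: "('o, 'm) exact_data \<Rightarrow> 'o \<Rightarrow> 'o \<Rightarrow> 'm set" where
  "Hom C X Y = {f \<in> Arr C. Dom C f = X \<and> Cod C f = Y}"

locale category =
  fixes C :: "('o, 'm) exact_data" (structure)
  assumes Dom_in_Obj: "f \<in> Arr C \<Longrightarrow> Dom C f \<in> Obj C"
    and Cod_in_Obj: "f \<in> Arr C \<Longrightarrow> Cod C f \<in> Obj C"
    and Ide_in_Hom: "X \<in> Obj C \<Longrightarrow> Ide C X \<in> Hom C X X"
    and Comp_in_Hom: "\<lbrakk>f \<in> Hom C X Y; g \<in> Hom C Y Z\<rbrakk> \<Longrightarrow> g \<cdot> f \<in> Hom C X Z"
    and Comp_Ide_right: "f \<in> Hom C X Y \<Longrightarrow> f \<cdot> Ide C X = f"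
    and Comp_Ide_left: "f \<in> Hom C X Y \<Longrightarrow> Ide C Y \<cdot> f = f"
    and Comp_assoc: "\<lbrakk>f \<in> Hom C W X; g \<in> Hom C X Y; h \<in> Hom C Y Z\<rbrakk>
      \<Longrightarrow> h \<cdot> (g \<cdot> f) = (h \<cdot> g) \<cdot> f"

definition is_iso_mor :: "('o, 'm) exact_data \<Rightarrow> 'm \<Rightarrow> bool" where
  "is_iso_mor C f \<longleftrightarrow> f \<in> Arr C \<and>
     (\<exists>g \<in> Hom C (Cod C f) (Dom C f).
        g \<cdot>\<^bsub>C\<^esub> f = Ide C (Dom C f) \<and> f \<cdot>\<^bsub>C\<^esub> g = Ide C (Cod C f))"

definition zero_object :: "('o, 'm) exact_data \<Rightarrow> 'o \<Rightarrow> bool" where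
  "zero_object C Z \<longleftrightarrow> Z \<in> Obj C \<and>
     (\<forall>X \<in> Obj C. (\<exists>!f. f \<in> Hom C X Z) \<and> (\<exists>!f. f \<in> Hom C Z X))"

definition is_biproduct ::
  "('o, 'm) exact_data \<Rightarrow> 'o \<Rightarrow> 'o \<Rightarrow> 'o \<Rightarrow> 'm \<Rightarrow> 'm \<Rightarrow> 'm \<Rightarrow> 'm \<Rightarrow> bool" where
  "is_biproduct C X Y P i j p q \<longleftrightarrow> P \<in> Obj C \<and>
     i \<in> Hom C X P \<and> j \<in> Hom C Y P \<and> p \<in> Hom C P X \<and> q \<in> Hom C P Y \<and>
     p \<cdot>\<^bsub>C\<^esub> i = Ide C X \<and> q \<cdot>\<^bsub>C\<^esub> j = Ide C Y \<and>
     p \<cdot>\<^bsub>C\<^esub> j = Zero C Y X \<and> q \<cdot>\<^bsub>C\<^esub> i = Zero C X Y \<and>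
     Add C (i \<cdot>\<^bsub>C\<^esub> p) (j \<cdot>\<^bsub>C\<^esub> q) = Ide C P"

locale additive_category = category +
  assumes Hom_comm_group: "\<lbrakk>X \<in> Obj C; Y \<in> Obj C\<rbrakk>
      \<Longrightarrow> comm_group \<lparr>carrier = Hom C X Y, monoid.mult = Add C, one = Zero C X Y\<rparr>"
    and Comp_Add_right: "\<lbrakk>f \<in> Hom C X Y; f' \<in> Hom C X Y; g \<in> Hom C Y Z\<rbrakk>
      \<Longrightarrow> g \<cdot> (Add C f f') = Add C (g \<cdot> f) (g \<cdot> f')"
    and Comp_Add_left: "\<lbrakk>f \<in> Hom C X Y; g \<in> Hom C Y Z; g' \<in> Hom C Y Z\<rbrakk>
      \<Longrightarrow> (Add C g g') \<cdot> f = Add C (g \<cdot> f) (g' \<cdot> f)"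
    and ex_zero_object: "\<exists>Z. zero_object C Z"
    and ex_biproduct: "\<lbrakk>X \<in> Obj C; Y \<in> Obj C\<rbrakk> \<Longrightarrow> \<exists>P i j p q. is_biproduct C X Y P i j p q"

definition is_kernel :: "('o, 'm) exact_data \<Rightarrow> 'm \<Rightarrow> 'm \<Rightarrow> bool" where
  "is_kernel C p i \<longleftrightarrow> i \<in> Arr C \<and> p \<in> Arr C \<and> Cod C i = Dom C p \<and>
     p \<cdot>\<^bsub>C\<^esub> i = Zero C (Dom C i) (Cod C p) \<and>
     (\<forall>W \<in> Obj C. \<forall>f \<in> Hom C W (Dom C p). p \<cdot>\<^bsub>C\<^esub> f = Zero C W (Cod C p) \<longrightarrow>
        (\<exists>!u. u \<in> Hom C W (Dom C i) \<and> i \<cdot>\<^bsub>C\<^esub> u = f))"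

definition is_cokernel :: "('o, 'm) exact_data \<Rightarrow> 'm \<Rightarrow> 'm \<Rightarrow> bool" where
  "is_cokernel C i p \<longleftrightarrow> i \<in> Arr C \<and> p \<in> Arr C \<and> Cod C i = Dom C p \<and>
     p \<cdot>\<^bsub>C\<^esub> i = Zero C (Dom C i) (Cod C p) \<and>
     (\<forall>W \<in> Obj C. \<forall>f \<in> Hom C (Cod C i) W. f \<cdot>\<^bsub>C\<^esub> i = Zero C (Dom C i) W \<longrightarrow>
        (\<exists>!u. u \<in> Hom C (Cod C p) W \<and> u \<cdot>\<^bsub>C\<^esub> p = f))"

text \<open>The square f q = g r is cartesian (the object Dom q = Dom r is the pullback of f, g).\<close>

definition is_pullback :: "('o, 'm) exact_data \<Rightarrow> 'm \<Rightarrow> 'm \<Rightarrow> 'm \<Rightarrow> 'm \<Rightarrow> bool" where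
  "is_pullback C f g q r \<longleftrightarrow> {f, g, q, r} \<subseteq> Arr C \<and> Cod C f = Cod C g \<and>
     Dom C q = Dom C r \<and> Cod C q = Dom C f \<and> Cod C r = Dom C g \<and>
     f \<cdot>\<^bsub>C\<^esub> q = g \<cdot>\<^bsub>C\<^esub> r \<and>
     (\<forall>W \<in> Obj C. \<forall>s \<in> Hom C W (Dom C f). \<forall>t \<in> Hom C W (Dom C g).
        f \<cdot>\<^bsub>C\<^esub> s = g \<cdot>\<^bsub>C\<^esub> t \<longrightarrow>
        (\<exists>!u. u \<in> Hom C W (Dom C q) \<and> q \<cdot>\<^bsub>C\<^esub> u = s \<and> r \<cdot>\<^bsub>C\<^esub> u = t))"

text \<open>The square q f = r g is cocartesian (the object Cod q = Cod r is the pushout of f, g).\<close>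

definition is_pushout :: "('o, 'm) exact_data \<Rightarrow> 'm \<Rightarrow> 'm \<Rightarrow> 'm \<Rightarrow> 'm \<Rightarrow> bool" where
  "is_pushout C f g q r \<longleftrightarrow> {f, g, q, r} \<subseteq> Arr C \<and> Dom C f = Dom C g \<and>
     Cod C q = Cod C r \<and> Dom C q = Cod C f \<and> Dom C r = Cod C g \<and>
     q \<cdot>\<^bsub>C\<^esub> f = r \<cdot>\<^bsub>C\<^esub> g \<and>
     (\<forall>W \<in> Obj C. \<forall>s \<in> Hom C (Cod C f) W. \<forall>t \<in> Hom C (Cod C g) W.
        s \<cdot>\<^bsub>C\<^esub> f = t \<cdot>\<^bsub>C\<^esub> g \<longrightarrow>
        (\<exists>!u. u \<in> Hom C (Cod C q) W \<and> u \<cdot>\<^bsub>C\<^esub> q = s \<and> u \<cdot>\<^bsub>C\<^esub> r = t))"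

definition adm_mono :: "('o, 'm) exact_data \<Rightarrow> 'm \<Rightarrow> bool" where
  "adm_mono C i \<longleftrightarrow> (\<exists>p. (i, p) \<in> SES C)"

definition adm_epi :: "('o, 'm) exact_data \<Rightarrow> 'm \<Rightarrow> bool" where
  "adm_epi C p \<longleftrightarrow> (\<exists>i. (i, p) \<in> SES C)"

text \<open>
  Quillen's axioms as in ``Higher algebraic K-theory I'', including the axioms
  adm\_epi\_cancel and adm\_mono\_cancel (Quillen's axiom c), which are now known to follow
  from the others.
\<close>

locale exact_category = additive_category +
  assumes SES_kernel: "(i, p) \<in> SES C \<Longrightarrow> is_kernel C p i"
    and SES_cokernel: "(i, p) \<in> SES C \<Longrightarrow> is_cokernel C i p"
    and SES_iso: "\<lbrakk>(i, p) \<in> SES C; i' \<in> Arr C; p' \<in> Arr C; Cod C i' = Dom C p';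
        is_iso_mor C a; is_iso_mor C b; is_iso_mor C c;
        a \<in> Hom C (Dom C i) (Dom C i'); b \<in> Hom C (Cod C i) (Cod C i');
        c \<in> Hom C (Cod C p) (Cod C p');
        b \<cdot> i = i' \<cdot> a; c \<cdot> p = p' \<cdot> b\<rbrakk> \<Longrightarrow> (i', p') \<in> SES C"
    and SES_split: "\<lbrakk>X \<in> Obj C; Y \<in> Obj C; is_biproduct C X Y P i j p q\<rbrakk> \<Longrightarrow> (i, q) \<in> SES C"
    and adm_epi_Comp: "\<lbrakk>adm_epi C p; adm_epi C q; Cod C p = Dom C q\<rbrakk> \<Longrightarrow> adm_epi C (q \<cdot> p)"
    and adm_mono_Comp: "\<lbrakk>adm_mono C i; adm_mono C j; Cod C i = Dom C j\<rbrakk> \<Longrightarrow> adm_mono C (j \<cdot> i)"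
    and adm_epi_pullback: "\<lbrakk>adm_epi C p; f \<in> Arr C; Cod C f = Cod C p\<rbrakk>
        \<Longrightarrow> \<exists>f' p'. is_pullback C p f f' p' \<and> adm_epi C p'"
    and adm_mono_pushout: "\<lbrakk>adm_mono C i; f \<in> Arr C; Dom C f = Dom C i\<rbrakk>
        \<Longrightarrow> \<exists>f' i'. is_pushout C i f f' i' \<and> adm_mono C i'"
    and adm_epi_cancel: "\<lbrakk>is_kernel C p k; e \<in> Arr C; Cod C e = Dom C p; adm_epi C (p \<cdot> e)\<rbrakk>
        \<Longrightarrow> adm_epi C p"
    and adm_mono_cancel: "\<lbrakk>is_cokernel C i k; e \<in> Arr C; Dom C e = Cod C i; adm_mono C (e \<cdot> i)\<rbrakk>
        \<Longrightarrow> adm_mono C i"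

section \<open>Exact subcategories and extension categories\<close>

text \<open>The full subcategory on a set S of objects, with the short exact sequences of C whose
  three terms all lie in S.\<close>

definition full_subcat :: "('o, 'm) exact_data \<Rightarrow> 'o set \<Rightarrow> ('o, 'm) exact_data" where
  "full_subcat C S = C\<lparr>
     Obj := S,
     Arr := {f \<in> Arr C. Dom C f \<in> S \<and> Cod C f \<in> S},
     SES := {(i, p) \<in> SES C. Dom C i \<in> S \<and> Cod C i \<in> S \<and> Cod C p \<in> S}\<rparr>"

definition exact_subcategory :: "('o, 'm) exact_data \<Rightarrow> 'o set \<Rightarrow> bool" where
  "exact_subcategory C S \<longleftrightarrow> S \<subseteq> Obj C \<and> additive_category (full_subcat C S) \<and>
     (\<forall>(i, p) \<in> SES C. Dom C i \<in> S \<and> Cod C p \<in> S \<longrightarrow> Cod C i \<in> S)"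

type_synonym 'm ext_obj = "'m \<times> 'm"
type_synonym 'm ext_mor = "'m ext_obj \<times> 'm ext_obj \<times> 'm \<times> 'm \<times> 'm"

definition ext_objs :: "('o, 'm) exact_data \<Rightarrow> 'o set \<Rightarrow> 'o set \<Rightarrow> 'm ext_obj set" where
  "ext_objs B SA SC = {(i, p) \<in> SES B. Dom B i \<in> SA \<and> Cod B p \<in> SC}"

definition ext_arrs :: "('o, 'm) exact_data \<Rightarrow> 'o set \<Rightarrow> 'o set \<Rightarrow> 'm ext_mor set" where
  "ext_arrs B SA SC = {((i, p), (i', p'), a, b, c) | i p i' p' a b c.
     (i, p) \<in> ext_objs B SA SC \<and> (i', p') \<in> ext_objs B SA SC \<and>
     a \<in> Hom B (Dom B i) (Dom B i') \<and> b \<in> Hom B (Cod B i) (Cod B i') \<and>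
     c \<in> Hom B (Cod B p) (Cod B p') \<and>
     b \<cdot>\<^bsub>B\<^esub> i = i' \<cdot>\<^bsub>B\<^esub> a \<and> c \<cdot>\<^bsub>B\<^esub> p = p' \<cdot>\<^bsub>B\<^esub> b}"

text \<open>The extension category E(A, B, C), where A and C are the full subcategories of B on the
  sets of objects SA and SC.\<close>

definition ext_cat ::
  "'o set \<Rightarrow> ('o, 'm) exact_data \<Rightarrow> 'o set \<Rightarrow> ('m ext_obj, 'm ext_mor) exact_data" where
  "ext_cat SA B SC = \<lparr>
     Obj  = ext_objs B SA SC,
     Arr  = ext_arrs B SA SC,
     Dom  = (\<lambda>(X, Y, a, b, c). X),
     Cod  = (\<lambda>(X, Y, a, b, c). Y),
     Ide  = (\<lambda>(i, p). ((i, p), (i, p), Ide B (Dom B i), Ide B (Cod B i), Ide B (Cod B p))),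
     Comp = (\<lambda>(Y, Z, a', b', c') (X, Y', a, b, c).
               (X, Z, a' \<cdot>\<^bsub>B\<^esub> a, b' \<cdot>\<^bsub>B\<^esub> b, c' \<cdot>\<^bsub>B\<^esub> c)),
     Zero = (\<lambda>(i, p) (i', p'). ((i, p), (i', p'),
               Zero B (Dom B i) (Dom B i'), Zero B (Cod B i) (Cod B i'),
               Zero B (Cod B p) (Cod B p'))),
     Add  = (\<lambda>(X, Y, a, b, c) (X', Y', a', b', c').
               (X, Y, Add B a a', Add B b b', Add B c c')),
     SES  = {((X, Y, a, b, c), (Y, Z, a', b', c')) | X Y Z a b c a' b' c'.
               (X, Y, a, b, c) \<in> ext_arrs B SA SC \<and> (Y, Z, a', b', c') \<in> ext_arrs B SA SC \<and>
               (a, a') \<in> SES (full_subcat B SA) \<and> (b, b') \<in> SES B \<and>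
               (c, c') \<in> SES (full_subcat B SC)}\<rparr>"

section \<open>Bounded acyclic binary multicomplexes\<close>

definition bounded_complex ::
  "('o, 'm) exact_data \<Rightarrow> (int \<Rightarrow> 'o) \<Rightarrow> (int \<Rightarrow> 'm) \<Rightarrow> bool" where
  "bounded_complex C N d \<longleftrightarrow>
     (\<forall>k. N k \<in> Obj C) \<and> (\<forall>k. d k \<in> Hom C (N k) (N (k - 1))) \<and>
     (\<forall>k. d (k - 1) \<cdot>\<^bsub>C\<^esub> d k = Zero C (N k) (N (k - 2))) \<and>
     (\<exists>m. \<forall>k. m < \<bar>k\<bar> \<longrightarrow> zero_object C (N k))"

text \<open>Here i k and p k are the two maps of the short exact sequence Z k >-> N k ->> Z (k - 1).\<close>

definition acyclic_complex ::
  "('o, 'm) exact_data \<Rightarrow> (int \<Rightarrow> 'o) \<Rightarrow> (int \<Rightarrow> 'm) \<Rightarrow> bool" where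
  "acyclic_complex C N d \<longleftrightarrow> bounded_complex C N d \<and>
     (\<exists>Z i p. \<forall>k. (i k, p k) \<in> SES C \<and>
        i k \<in> Hom C (Z k) (N k) \<and> p k \<in> Hom C (N k) (Z (k - 1)) \<and>
        d k = i (k - 1) \<cdot>\<^bsub>C\<^esub> p k)"

text \<open>
  The objects of the iterated categories of binary complexes have a type that grows with the
  number of iterations. To be able to iterate up to a variable n, all of them are embedded in
  one recursive type: a binary complex consists of a graded object and two families of
  morphisms, and a morphism of binary complexes consists of its source, its target and its
  components, where the constituents may again be binary complexes and morphisms between them.
\<close>

datatype ('o, 'm) mobj =
    Base_obj 'o
  | Cx (gr: "int \<Rightarrow> ('o, 'm) mobj") (dff: "int \<Rightarrow> ('o, 'm) mmor") (dff': "int \<Rightarrow> ('o, 'm) mmor")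
and ('o, 'm) mmor =
    Base_mor 'm
  | Cx_mor (src: "('o, 'm) mobj") (tgt: "('o, 'm) mobj") (cpt: "int \<Rightarrow> ('o, 'm) mmor")

text \<open>A copy of N inside the recursive type.\<close>

primrec base_obj :: "('o, 'm) mobj \<Rightarrow> 'o" where
  "base_obj (Base_obj X) = X"

primrec base_mor :: "('o, 'm) mmor \<Rightarrow> 'm" where
  "base_mor (Base_mor f) = f"

definition base_cat :: "('o, 'm) exact_data \<Rightarrow> (('o, 'm) mobj, ('o, 'm) mmor) exact_data" where
  "base_cat N = \<lparr>
     Obj  = Base_obj ` Obj N,
     Arr  = Base_mor ` Arr N,
     Dom  = (\<lambda>f. Base_obj (Dom N (base_mor f))),
     Cod  = (\<lambda>f. Base_obj (Cod N (base_mor f))),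
     Ide  = (\<lambda>X. Base_mor (Ide N (base_obj X))),
     Comp = (\<lambda>g f. Base_mor (base_mor g \<cdot>\<^bsub>N\<^esub> base_mor f)),
     Zero = (\<lambda>X Y. Base_mor (Zero N (base_obj X) (base_obj Y))),
     Add  = (\<lambda>f g. Base_mor (Add N (base_mor f) (base_mor g))),
     SES  = {(Base_mor i, Base_mor p) | i p. (i, p) \<in> SES N}\<rparr>"

type_synonym ('o, 'm) mcat = "(('o, 'm) mobj, ('o, 'm) mmor) exact_data"

definition Bq_objs :: "('o, 'm) mcat \<Rightarrow> ('o, 'm) mobj set" where
  "Bq_objs C = {Cx N d d' | N d d'. acyclic_complex C N d \<and> acyclic_complex C N d'}"

definition Bq_arrs :: "('o, 'm) mcat \<Rightarrow> ('o, 'm) mmor set" where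
  "Bq_arrs C = {Cx_mor X Y f | X Y f. X \<in> Bq_objs C \<and> Y \<in> Bq_objs C \<and>
     (\<forall>k. f k \<in> Hom C (gr X k) (gr Y k) \<and>
        f (k - 1) \<cdot>\<^bsub>C\<^esub> dff X k = dff Y k \<cdot>\<^bsub>C\<^esub> f k \<and>
        f (k - 1) \<cdot>\<^bsub>C\<^esub> dff' X k = dff' Y k \<cdot>\<^bsub>C\<^esub> f k)}"

definition Bq :: "('o, 'm) mcat \<Rightarrow> ('o, 'm) mcat" where
  "Bq C = \<lparr>
     Obj  = Bq_objs C,
     Arr  = Bq_arrs C,
     Dom  = src,
     Cod  = tgt,
     Ide  = (\<lambda>X. Cx_mor X X (\<lambda>k. Ide C (gr X k))),
     Comp = (\<lambda>g f. Cx_mor (src f) (tgt g) (\<lambda>k. cpt g k \<cdot>\<^bsub>C\<^esub> cpt f k)),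
     Zero = (\<lambda>X Y. Cx_mor X Y (\<lambda>k. Zero C (gr X k) (gr Y k))),
     Add  = (\<lambda>f g. Cx_mor (src f) (tgt f) (\<lambda>k. Add C (cpt f k) (cpt g k))),
     SES  = {(i, p). i \<in> Bq_arrs C \<and> p \<in> Bq_arrs C \<and> tgt i = src p \<and>
               (\<forall>k. (cpt i k, cpt p k) \<in> SES C)}\<rparr>"

definition Bq_pow :: "nat \<Rightarrow> ('o, 'm) exact_data \<Rightarrow> ('o, 'm) mcat" where
  "Bq_pow n N = (Bq ^^ n) (base_cat N)"

text \<open>Direction 0 is the outermost one. A multicomplex is diagonal in an inner direction if
  the two differentials in that direction agree on each of its slices.\<close>

fun diagonal_in :: "nat \<Rightarrow> ('o, 'm) mobj \<Rightarrow> bool" where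
  "diagonal_in i (Base_obj X) \<longleftrightarrow> False"
| "diagonal_in 0 (Cx N d d') \<longleftrightarrow> d = d'"
| "diagonal_in (Suc i) (Cx N d d') \<longleftrightarrow> (\<forall>k. diagonal_in i (N k))"

definition diagonal :: "nat \<Rightarrow> ('o, 'm) mobj \<Rightarrow> bool" where
  "diagonal n X \<longleftrightarrow> (\<exists>i < n. diagonal_in i X)"

section \<open>K-groups\<close>

definition K_relations :: "nat \<Rightarrow> ('o, 'm) exact_data \<Rightarrow> (('o, 'm) mobj \<Rightarrow>\<^sub>0 int) set" where
  "K_relations n N =
     {frag_of (Dom (Bq_pow n N) i) + frag_of (Cod (Bq_pow n N) p) - frag_of (Cod (Bq_pow n N) i)
        | i p. (i, p) \<in> SES (Bq_pow n N)} \<union>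
     {frag_of T | T. T \<in> Obj (Bq_pow n N) \<and> diagonal n T}"

definition K_group :: "nat \<Rightarrow> ('o, 'm) exact_data \<Rightarrow> (('o, 'm) mobj \<Rightarrow>\<^sub>0 int) set monoid" where
  "K_group n N = free_Abelian_group (Obj (Bq_pow n N)) Mod
     generate (free_Abelian_group (Obj (Bq_pow n N))) (K_relations n N)"

end

theory Submission
  imports Defs
begin

text \<open>
  An exact functor acts entrywise on multicomplexes and preserves diagonal ones, so it induces
  maps of K-groups; a natural short exact sequence of exact functors F' >-> F ->> F'' lifts
  entrywise as well, whence K(F) = K(F') + K(F''). Let s and q send an extension A >-> B ->> C to
  A and C, and let i and j send A to A >-> A ->> 0 and C to 0 >-> C ->> C. Then s i and q j are
  identities, q i and s j are functors F constant at a zero object, for which F >-> F ->> F gives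
  K(F) = 2 K(F) = 0, and i s >-> id ->> j q is a natural short exact sequence. Hence (s, q) is
  inverse to (a, c) |-> i a + j c on K-groups.
\<close>

section \<open>Categories with zero morphisms and short exact sequences\<close>

text \<open>Every hypothesis used in the induction on n has to survive \<open>Bq\<close>. The
  invariant chosen is \<open>pointed_category\<close>: category laws, absorbing zero morphisms and
  composable short exact sequences. It is checked entry by entry. Boundedness of complexes is stated
  through the universal property of zero objects; inside this setting it becomes the equation
  \<open>Ide X = Zero X X\<close>, which a functor visibly preserves.

  The lift of a functor is the same pair of functions at every level: the datatype maps
  \<open>map_mobj F G\<close> and \<open>map_mmor F G\<close> reach all entries at any depth, and
  they compose strictly. The functors are therefore set up so that s i and q j equal the identity on
  the nose, and all computations take place in free groups modulo the span of the relations.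

  The two subcategories may have different zero objects. An extension built from an object of
  \<open>SA\<close> is completed by a zero object \<open>ZC\<close> of \<open>SC\<close>, and one
  built from an object of \<open>SC\<close> by a zero object \<open>ZA\<close> of
  \<open>SA\<close>.\<close>

locale pointed_category = category +
  assumes Zero_in_Hom: "\<lbrakk>X \<in> Obj C; Y \<in> Obj C\<rbrakk> \<Longrightarrow> Zero C X Y \<in> Hom C X Y"
    and Comp_Zero_right: "\<lbrakk>X \<in> Obj C; g \<in> Hom C Y Z\<rbrakk> \<Longrightarrow> g \<cdot> Zero C X Y = Zero C X Z"
    and Comp_Zero_left: "\<lbrakk>f \<in> Hom C X Y; Z \<in> Obj C\<rbrakk> \<Longrightarrow> Zero C Y Z \<cdot> f = Zero C X Z"
    and SES_composable: "(i, p) \<in> SES C \<Longrightarrow> i \<in> Arr C \<and> p \<in> Arr C \<and> Cod C i = Dom C p"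

lemma HomD: "f \<in> Hom C X Y \<Longrightarrow> f \<in> Arr C \<and> Dom C f = X \<and> Cod C f = Y"
  by (simp add: Hom_def)

lemma HomI: "\<lbrakk>f \<in> Arr C; Dom C f = X; Cod C f = Y\<rbrakk> \<Longrightarrow> f \<in> Hom C X Y"
  by (simp add: Hom_def)

lemma (in category) Hom_Obj:
  assumes "f \<in> Hom C X Y"
  shows "X \<in> Obj C" "Y \<in> Obj C"
  using assms Dom_in_Obj Cod_in_Obj by (auto simp: Hom_def)

text \<open>Pasting of two commuting squares along \<open>e\<close>. It is the reason that
  composites commute with the differentials in \<open>Bq\<close>, and with the structure maps in the
  extension category.\<close>

lemma (in category) Comp_square:
  assumes "f \<in> Hom C X Y" "g \<in> Hom C Y Z" "f' \<in> Hom C X' Y'" "g' \<in> Hom C Y' Z'"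
    and "d \<in> Hom C X X'" "e \<in> Hom C Y Y'" "h \<in> Hom C Z Z'"
    and "f' \<cdot> d = e \<cdot> f" "g' \<cdot> e = h \<cdot> g"
  shows "(g' \<cdot> f') \<cdot> d = h \<cdot> (g \<cdot> f)"
proof -
  have "(g' \<cdot> f') \<cdot> d = g' \<cdot> (f' \<cdot> d)"
    using Comp_assoc[OF assms(5,3,4)] by simp
  also have "\<dots> = (g' \<cdot> e) \<cdot> f"
    using Comp_assoc[OF assms(1,6,4)] assms by simp
  also have "\<dots> = h \<cdot> (g \<cdot> f)"
    using Comp_assoc[OF assms(1,2,7)] assms by simp
  finally show ?thesis .
qed

text \<open>If the identity of X is zero, every morphism into or out of X equals its composite with
  that identity and so vanishes. The equation on the right is preserved by any functor respecting
  \<open>Ide\<close> and \<open>Zero\<close>, whereas the universal property quantifies over the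
  objects of one category.\<close>

lemma (in pointed_category) zero_object_iff:
  assumes "X \<in> Obj C"
  shows "zero_object C X \<longleftrightarrow> Ide C X = Zero C X X"
proof
  assume "zero_object C X"
  then show "Ide C X = Zero C X X"
    using assms Ide_in_Hom Zero_in_Hom unfolding zero_object_def by blast
next
  assume eq: "Ide C X = Zero C X X"
  have "f = Zero C Y X" if "f \<in> Hom C Y X" for f Y
    using that assms by (metis Comp_Ide_left Comp_Zero_left eq)
  moreover have "f = Zero C X Y" if "f \<in> Hom C X Y" for f Y
    using that assms by (metis Comp_Ide_right Comp_Zero_right eq)
  ultimately show "zero_object C X"
    unfolding zero_object_def using assms Zero_in_Hom by blast
qed

section \<open>Zero morphisms in additive categories\<close>

lemma (in additive_category) Zero_Hom:
  assumes "X \<in> Obj C" "Y \<in> Obj C"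
  shows "Zero C X Y \<in> Hom C X Y"
proof -
  interpret H: comm_group "\<lparr>carrier = Hom C X Y, monoid.mult = Add C, one = Zero C X Y\<rparr>"
    using Hom_comm_group assms .
  show ?thesis using H.one_closed by simp
qed

lemma (in additive_category) Add_Zero_Zero:
  assumes "X \<in> Obj C" "Y \<in> Obj C"
  shows "Add C (Zero C X Y) (Zero C X Y) = Zero C X Y"
proof -
  interpret H: comm_group "\<lparr>carrier = Hom C X Y, monoid.mult = Add C, one = Zero C X Y\<rparr>"
    using Hom_comm_group assms .
  show ?thesis using H.l_one[OF H.one_closed] by simp
qed

lemma (in additive_category) Add_idem_Zero:
  assumes "f \<in> Hom C X Y" "Add C f f = f"
  shows "f = Zero C X Y"
proof -
  interpret H: comm_group "\<lparr>carrier = Hom C X Y, monoid.mult = Add C, one = Zero C X Y\<rparr>"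
    using Hom_comm_group Hom_Obj[OF assms(1)] .
  show ?thesis using H.r_cancel_one[of f f] assms by simp
qed

lemma (in additive_category) Add_Zero_left:
  assumes "f \<in> Hom C X Y"
  shows "Add C (Zero C X Y) f = f"
proof -
  interpret H: comm_group "\<lparr>carrier = Hom C X Y, monoid.mult = Add C, one = Zero C X Y\<rparr>"
    using Hom_comm_group Hom_Obj[OF assms(1)] .
  show ?thesis using H.l_one[of f] assms by simp
qed

lemma (in additive_category) Add_Zero_right:
  assumes "f \<in> Hom C X Y"
  shows "Add C f (Zero C X Y) = f"
proof -
  interpret H: comm_group "\<lparr>carrier = Hom C X Y, monoid.mult = Add C, one = Zero C X Y\<rparr>"
    using Hom_comm_group Hom_Obj[OF assms(1)] .
  show ?thesis using H.r_one[of f] assms by simp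
qed

text \<open>By bilinearity g 0 = g (0 + 0) = g 0 + g 0, so g 0 is idempotent in the Hom group and
  hence zero; likewise on the other side. Composability of the sequences is a premise, so that the
  rule also serves a full subcategory known to be additive, where it is inherited from the ambient
  category.\<close>

lemma (in additive_category) pointed_categoryI:
  assumes "\<And>i p. (i, p) \<in> SES C \<Longrightarrow> i \<in> Arr C \<and> p \<in> Arr C \<and> Cod C i = Dom C p"
  shows "pointed_category C"
proof
  show "Zero C X Y \<in> Hom C X Y" if "X \<in> Obj C" "Y \<in> Obj C" for X Y
    using Zero_Hom that .
  show "g \<cdot> Zero C X Y = Zero C X Z" if "X \<in> Obj C" "g \<in> Hom C Y Z" for X Y Z g
  proof (rule Add_idem_Zero)
    have z: "Zero C X Y \<in> Hom C X Y" using Zero_Hom that Hom_Obj by blast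
    show "g \<cdot> Zero C X Y \<in> Hom C X Z" using z Comp_in_Hom that by blast
    show "Add C (g \<cdot> Zero C X Y) (g \<cdot> Zero C X Y) = g \<cdot> Zero C X Y"
      using Comp_Add_right[OF z z that(2)] Add_Zero_Zero[of X Y] that Hom_Obj[OF that(2)] by simp
  qed
  show "Zero C Y Z \<cdot> f = Zero C X Z" if "f \<in> Hom C X Y" "Z \<in> Obj C" for X Y Z f
  proof (rule Add_idem_Zero)
    have z: "Zero C Y Z \<in> Hom C Y Z" using Zero_Hom that Hom_Obj by blast
    show "Zero C Y Z \<cdot> f \<in> Hom C X Z" using z Comp_in_Hom that by blast
    show "Add C (Zero C Y Z \<cdot> f) (Zero C Y Z \<cdot> f) = Zero C Y Z \<cdot> f"
      using Comp_Add_left[OF that(1) z z] Add_Zero_Zero[of Y Z] that Hom_Obj[OF that(1)] by simp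
  qed
qed (use assms in blast)

section \<open>The copy of a category inside the recursive type\<close>

lemma base_cat_simps [simp]:
  "Obj (base_cat N) = Base_obj ` Obj N" "Arr (base_cat N) = Base_mor ` Arr N"
  "Dom (base_cat N) f = Base_obj (Dom N (base_mor f))"
  "Cod (base_cat N) f = Base_obj (Cod N (base_mor f))"
  "Ide (base_cat N) X = Base_mor (Ide N (base_obj X))"
  "Comp (base_cat N) g f = Base_mor (Comp N (base_mor g) (base_mor f))"
  "Zero (base_cat N) X Y = Base_mor (Zero N (base_obj X) (base_obj Y))"
  "SES (base_cat N) = {(Base_mor i, Base_mor p) | i p. (i, p) \<in> SES N}"
  by (simp_all add: base_cat_def)

lemma Hom_base_cat: "f \<in> Hom (base_cat N) X Y \<longleftrightarrow>
    (\<exists>f' X' Y'. f = Base_mor f' \<and> X = Base_obj X' \<and> Y = Base_obj Y' \<and> f' \<in> Hom N X' Y')"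
  by (auto simp: Hom_def)

lemma pointed_category_base_cat:
  assumes "pointed_category N"
  shows "pointed_category (base_cat N)"
proof -
  interpret pointed_category N by fact
  show ?thesis
  proof
    fix f X Y g Z h W
    show "f \<in> Arr (base_cat N) \<Longrightarrow> Dom (base_cat N) f \<in> Obj (base_cat N)"
      using Dom_in_Obj by auto
    show "f \<in> Arr (base_cat N) \<Longrightarrow> Cod (base_cat N) f \<in> Obj (base_cat N)"
      using Cod_in_Obj by auto
    show "X \<in> Obj (base_cat N) \<Longrightarrow> Ide (base_cat N) X \<in> Hom (base_cat N) X X"
      using Ide_in_Hom by (auto simp: Hom_base_cat)
    show "\<lbrakk>f \<in> Hom (base_cat N) X Y; g \<in> Hom (base_cat N) Y Z\<rbrakk>
      \<Longrightarrow> g \<cdot>\<^bsub>base_cat N\<^esub> f \<in> Hom (base_cat N) X Z"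
      using Comp_in_Hom by (auto simp: Hom_base_cat)
    show "f \<in> Hom (base_cat N) X Y \<Longrightarrow> f \<cdot>\<^bsub>base_cat N\<^esub> Ide (base_cat N) X = f"
      using Comp_Ide_right by (auto simp: Hom_base_cat)
    show "f \<in> Hom (base_cat N) X Y \<Longrightarrow> Ide (base_cat N) Y \<cdot>\<^bsub>base_cat N\<^esub> f = f"
      using Comp_Ide_left by (auto simp: Hom_base_cat)
    show "\<lbrakk>f \<in> Hom (base_cat N) W X; g \<in> Hom (base_cat N) X Y; h \<in> Hom (base_cat N) Y Z\<rbrakk>
      \<Longrightarrow> h \<cdot>\<^bsub>base_cat N\<^esub> (g \<cdot>\<^bsub>base_cat N\<^esub> f) = h \<cdot>\<^bsub>base_cat N\<^esub> g \<cdot>\<^bsub>base_cat N\<^esub> f"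
      using Comp_assoc by (auto simp: Hom_base_cat)
    show "\<lbrakk>X \<in> Obj (base_cat N); Y \<in> Obj (base_cat N)\<rbrakk>
      \<Longrightarrow> Zero (base_cat N) X Y \<in> Hom (base_cat N) X Y"
      using Zero_in_Hom by (auto simp: Hom_base_cat)
    show "\<lbrakk>X \<in> Obj (base_cat N); g \<in> Hom (base_cat N) Y Z\<rbrakk>
      \<Longrightarrow> g \<cdot>\<^bsub>base_cat N\<^esub> Zero (base_cat N) X Y = Zero (base_cat N) X Z"
      using Comp_Zero_right by (auto simp: Hom_base_cat)
    show "\<lbrakk>f \<in> Hom (base_cat N) X Y; Z \<in> Obj (base_cat N)\<rbrakk>
      \<Longrightarrow> Zero (base_cat N) Y Z \<cdot>\<^bsub>base_cat N\<^esub> f = Zero (base_cat N) X Z"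
      using Comp_Zero_left by (auto simp: Hom_base_cat)
    show "(f, g) \<in> SES (base_cat N) \<Longrightarrow> f \<in> Arr (base_cat N) \<and> g \<in> Arr (base_cat N)
      \<and> Cod (base_cat N) f = Dom (base_cat N) g"
      using SES_composable by auto
  qed
qed

section \<open>Categories of binary complexes\<close>

lemma Bq_simps [simp]:
  "Obj (Bq C) = Bq_objs C" "Arr (Bq C) = Bq_arrs C" "Dom (Bq C) = src" "Cod (Bq C) = tgt"
  "Ide (Bq C) X = Cx_mor X X (\<lambda>k. Ide C (gr X k))"
  "Comp (Bq C) g f = Cx_mor (src f) (tgt g) (\<lambda>k. Comp C (cpt g k) (cpt f k))"
  "Zero (Bq C) X Y = Cx_mor X Y (\<lambda>k. Zero C (gr X k) (gr Y k))"
  "SES (Bq C) = {(i, p). i \<in> Bq_arrs C \<and> p \<in> Bq_arrs C \<and> tgt i = src p \<and>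
               (\<forall>k. (cpt i k, cpt p k) \<in> SES C)}"
  by (simp_all add: Bq_def)

lemma Bq_objsD:
  assumes "X \<in> Bq_objs C"
  shows "X = Cx (gr X) (dff X) (dff' X)" "acyclic_complex C (gr X) (dff X)"
    "acyclic_complex C (gr X) (dff' X)" "gr X k \<in> Obj C"
    "dff X k \<in> Hom C (gr X k) (gr X (k - 1))" "dff' X k \<in> Hom C (gr X k) (gr X (k - 1))"
proof -
  obtain N d d' where X: "X = Cx N d d'" "acyclic_complex C N d" "acyclic_complex C N d'"
    using assms by (auto simp: Bq_objs_def)
  then show "X = Cx (gr X) (dff X) (dff' X)" "acyclic_complex C (gr X) (dff X)"
    "acyclic_complex C (gr X) (dff' X)" by simp_all
  then show "gr X k \<in> Obj C" "dff X k \<in> Hom C (gr X k) (gr X (k - 1))"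
    "dff' X k \<in> Hom C (gr X k) (gr X (k - 1))"
    by (simp_all add: acyclic_complex_def bounded_complex_def)
qed

lemma Hom_Bq: "f \<in> Hom (Bq C) X Y \<longleftrightarrow> f = Cx_mor X Y (cpt f) \<and> X \<in> Bq_objs C \<and> Y \<in> Bq_objs C \<and>
    (\<forall>k. cpt f k \<in> Hom C (gr X k) (gr Y k) \<and>
       cpt f (k - 1) \<cdot>\<^bsub>C\<^esub> dff X k = dff Y k \<cdot>\<^bsub>C\<^esub> cpt f k \<and>
       cpt f (k - 1) \<cdot>\<^bsub>C\<^esub> dff' X k = dff' Y k \<cdot>\<^bsub>C\<^esub> cpt f k)"
  by (cases f) (auto simp: Hom_def Bq_arrs_def)

text \<open>Once a morphism is exposed as a \<open>Cx_mor\<close> over known source and target, an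
  equation between morphisms reduces by extensionality to its components. The unit, associativity
  and zero laws of \<open>Bq C\<close> follow in this way.\<close>

lemma Hom_BqE:
  assumes "f \<in> Hom (Bq C) X Y"
  obtains h where "f = Cx_mor X Y h" "X \<in> Bq_objs C" "Y \<in> Bq_objs C"
    "\<And>k. h k \<in> Hom C (gr X k) (gr Y k)"
  using assms by (auto simp: Hom_Bq)

text \<open>All laws hold degree by degree. The content beyond the components is that identities,
  composites and zero morphisms commute with both differentials: by the unit laws, by pasting, and
  because both sides vanish.\<close>

lemma pointed_category_Bq:
  assumes "pointed_category C"
  shows "pointed_category (Bq C)"
proof -
  interpret pointed_category C by fact
  show ?thesis
  proof
    fix f X Y g Z h W
    show "f \<in> Arr (Bq C) \<Longrightarrow> Dom (Bq C) f \<in> Obj (Bq C)"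
      by (auto simp: Bq_arrs_def)
    show "f \<in> Arr (Bq C) \<Longrightarrow> Cod (Bq C) f \<in> Obj (Bq C)"
      by (auto simp: Bq_arrs_def)
    show "X \<in> Obj (Bq C) \<Longrightarrow> Ide (Bq C) X \<in> Hom (Bq C) X X"
      using Ide_in_Hom Bq_objsD[of X C] Comp_Ide_left[OF Bq_objsD(5)[of X C]]
        Comp_Ide_right[OF Bq_objsD(5)[of X C]] Comp_Ide_left[OF Bq_objsD(6)[of X C]]
        Comp_Ide_right[OF Bq_objsD(6)[of X C]] by (simp add: Hom_Bq)
    show "g \<cdot>\<^bsub>Bq C\<^esub> f \<in> Hom (Bq C) X Z" if f: "f \<in> Hom (Bq C) X Y" and g: "g \<in> Hom (Bq C) Y Z"
    proof -
      have X: "X \<in> Bq_objs C" and Y: "Y \<in> Bq_objs C" and Z: "Z \<in> Bq_objs C"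
        and fk: "\<And>k. cpt f k \<in> Hom C (gr X k) (gr Y k)"
        and gk: "\<And>k. cpt g k \<in> Hom C (gr Y k) (gr Z k)"
        and f_sq: "\<And>k. cpt f (k - 1) \<cdot>\<^bsub>C\<^esub> dff X k = dff Y k \<cdot>\<^bsub>C\<^esub> cpt f k"
          "\<And>k. cpt f (k - 1) \<cdot>\<^bsub>C\<^esub> dff' X k = dff' Y k \<cdot>\<^bsub>C\<^esub> cpt f k"
        and g_sq: "\<And>k. cpt g (k - 1) \<cdot>\<^bsub>C\<^esub> dff Y k = dff Z k \<cdot>\<^bsub>C\<^esub> cpt g k"
          "\<And>k. cpt g (k - 1) \<cdot>\<^bsub>C\<^esub> dff' Y k = dff' Z k \<cdot>\<^bsub>C\<^esub> cpt g k"
        using f g by (auto simp: Hom_Bq)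
      have st: "src f = X" "tgt g = Z"
        using HomD[OF f] HomD[OF g] by auto
      \<comment> \<open>\<open>fk\<close> and \<open>gk\<close> enter each pasting twice: in degree
        k and, as the opposite side of the squares, in degree k - 1.\<close>
      show ?thesis
        using X Z Comp_in_Hom[OF fk gk]
          Comp_square[OF fk gk fk gk Bq_objsD(5)[OF X] Bq_objsD(5)[OF Y] Bq_objsD(5)[OF Z] f_sq(1) g_sq(1)]
          Comp_square[OF fk gk fk gk Bq_objsD(6)[OF X] Bq_objsD(6)[OF Y] Bq_objsD(6)[OF Z] f_sq(2) g_sq(2)]
        by (simp add: Hom_Bq st)
    qed
    show "f \<in> Hom (Bq C) X Y \<Longrightarrow> f \<cdot>\<^bsub>Bq C\<^esub> Ide (Bq C) X = f"
      by (auto elim!: Hom_BqE intro!: ext Comp_Ide_right)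
    show "f \<in> Hom (Bq C) X Y \<Longrightarrow> Ide (Bq C) Y \<cdot>\<^bsub>Bq C\<^esub> f = f"
      by (auto elim!: Hom_BqE intro!: ext Comp_Ide_left)
    show "\<lbrakk>f \<in> Hom (Bq C) W X; g \<in> Hom (Bq C) X Y; h \<in> Hom (Bq C) Y Z\<rbrakk>
      \<Longrightarrow> h \<cdot>\<^bsub>Bq C\<^esub> (g \<cdot>\<^bsub>Bq C\<^esub> f) = h \<cdot>\<^bsub>Bq C\<^esub> g \<cdot>\<^bsub>Bq C\<^esub> f"
      by (auto elim!: Hom_BqE intro!: ext Comp_assoc)
    show "\<lbrakk>X \<in> Obj (Bq C); Y \<in> Obj (Bq C)\<rbrakk> \<Longrightarrow> Zero (Bq C) X Y \<in> Hom (Bq C) X Y"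
      using Zero_in_Hom Bq_objsD(4)[of X C] Bq_objsD(4)[of Y C]
        Comp_Zero_left[OF Bq_objsD(5)[of X C]] Comp_Zero_right[OF _ Bq_objsD(5)[of Y C]]
        Comp_Zero_left[OF Bq_objsD(6)[of X C]] Comp_Zero_right[OF _ Bq_objsD(6)[of Y C]]
      by (simp add: Hom_Bq)
    show "\<lbrakk>X \<in> Obj (Bq C); g \<in> Hom (Bq C) Y Z\<rbrakk> \<Longrightarrow> g \<cdot>\<^bsub>Bq C\<^esub> Zero (Bq C) X Y = Zero (Bq C) X Z"
      by (auto elim!: Hom_BqE intro!: ext Comp_Zero_right Bq_objsD(4))
    show "\<lbrakk>f \<in> Hom (Bq C) X Y; Z \<in> Obj (Bq C)\<rbrakk> \<Longrightarrow> Zero (Bq C) Y Z \<cdot>\<^bsub>Bq C\<^esub> f = Zero (Bq C) X Z"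
      by (auto elim!: Hom_BqE intro!: ext Comp_Zero_left Bq_objsD(4))
    show "(f, g) \<in> SES (Bq C) \<Longrightarrow> f \<in> Arr (Bq C) \<and> g \<in> Arr (Bq C) \<and> Cod (Bq C) f = Dom (Bq C) g"
      by simp
  qed
qed

lemma Bq_pow_0 [simp]: "Bq_pow 0 N = base_cat N"
  and Bq_pow_Suc [simp]: "Bq_pow (Suc n) N = Bq (Bq_pow n N)"
  by (simp_all add: Bq_pow_def)

lemma pointed_category_Bq_pow: "pointed_category N \<Longrightarrow> pointed_category (Bq_pow n N)"
  by (induction n) (simp_all add: pointed_category_base_cat pointed_category_Bq)

section \<open>Exact functors and natural short exact sequences\<close>

text \<open>Objects and morphisms get separate functions because the datatype maps take one function
  for each kind of leaf. Preservation of \<open>Zero\<close> carries over d d = 0 and, together with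
  \<open>Ide\<close>, zero objects and thus boundedness.\<close>

definition exact_functor ::
  "('o, 'm) exact_data \<Rightarrow> ('p, 'n) exact_data \<Rightarrow> ('o \<Rightarrow> 'p) \<Rightarrow> ('m \<Rightarrow> 'n) \<Rightarrow> bool" where
  "exact_functor C D F G \<longleftrightarrow> (\<forall>X \<in> Obj C. F X \<in> Obj D) \<and>
     (\<forall>X Y. \<forall>f \<in> Hom C X Y. G f \<in> Hom D (F X) (F Y)) \<and>
     (\<forall>X \<in> Obj C. G (Ide C X) = Ide D (F X)) \<and>
     (\<forall>X Y Z. \<forall>f \<in> Hom C X Y. \<forall>g \<in> Hom C Y Z. G (g \<cdot>\<^bsub>C\<^esub> f) = G g \<cdot>\<^bsub>D\<^esub> G f) \<and>
     (\<forall>X \<in> Obj C. \<forall>Y \<in> Obj C. G (Zero C X Y) = Zero D (F X) (F Y)) \<and>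
     (\<forall>(i, p) \<in> SES C. (G i, G p) \<in> SES D)"

lemma exact_functorD:
  assumes "exact_functor C D F G"
  shows "X \<in> Obj C \<Longrightarrow> F X \<in> Obj D"
    "f \<in> Hom C X Y \<Longrightarrow> G f \<in> Hom D (F X) (F Y)"
    "X \<in> Obj C \<Longrightarrow> G (Ide C X) = Ide D (F X)"
    "\<lbrakk>f \<in> Hom C X Y; g \<in> Hom C Y Z\<rbrakk> \<Longrightarrow> G (g \<cdot>\<^bsub>C\<^esub> f) = G g \<cdot>\<^bsub>D\<^esub> G f"
    "\<lbrakk>X \<in> Obj C; Y \<in> Obj C\<rbrakk> \<Longrightarrow> G (Zero C X Y) = Zero D (F X) (F Y)"
    "(i, p) \<in> SES C \<Longrightarrow> (G i, G p) \<in> SES D"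
  using assms unfolding exact_functor_def by auto

lemma exact_functor_zero_object:
  assumes "pointed_category C" "pointed_category D" "exact_functor C D F G" "zero_object C X"
  shows "zero_object D (F X)"
  using assms exact_functorD[OF assms(3)] pointed_category.zero_object_iff
  by (metis zero_object_def)

text \<open>The image of a factorization through cycles is again one: the cycles of the image are
  \<open>F \<circ> Z\<close>, with structure maps \<open>G \<circ> i\<close> and
  \<open>G \<circ> p\<close>. The bound m is unchanged.\<close>

lemma exact_functor_acyclic_complex:
  assumes C: "pointed_category C" and D: "pointed_category D" and F: "exact_functor C D F G"
    and N: "acyclic_complex C N d"
  shows "acyclic_complex D (F \<circ> N) (G \<circ> d)"
proof -
  note [simp] = exact_functorD[OF F]
  from N obtain Z i p where Z: "\<And>k. (i k, p k) \<in> SES C" "\<And>k. i k \<in> Hom C (Z k) (N k)"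
    "\<And>k. p k \<in> Hom C (N k) (Z (k - 1))" "\<And>k. d k = i (k - 1) \<cdot>\<^bsub>C\<^esub> p k"
    and bd: "bounded_complex C N d"
    unfolding acyclic_complex_def by metis
  have obj: "N k \<in> Obj C" and d: "d k \<in> Hom C (N k) (N (k - 1))" 
    and dd: "d (k - 1) \<cdot>\<^bsub>C\<^esub> d k = Zero C (N k) (N (k - 2))" for k
    using bd by (auto simp: bounded_complex_def)
  have "G (d (k - 1)) \<cdot>\<^bsub>D\<^esub> G (d k) = Zero D (F (N k)) (F (N (k - 2)))" for k
    using exact_functorD(4)[OF F d[of k] d[of "k - 1"]] by (simp add: dd obj)
  moreover obtain m where "\<And>k. m < \<bar>k\<bar> \<Longrightarrow> zero_object C (N k)"
    using bd by (auto simp: bounded_complex_def)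
  then have "\<exists>m. \<forall>k. m < \<bar>k\<bar> \<longrightarrow> zero_object D (F (N k))"
    using exact_functor_zero_object[OF C D F] by blast
  ultimately have "bounded_complex D (F \<circ> N) (G \<circ> d)"
    using obj d by (simp add: bounded_complex_def)
  moreover have "G (d k) = G (i (k - 1)) \<cdot>\<^bsub>D\<^esub> G (p k)" for k
    using exact_functorD(4)[OF F Z(3)[of k] Z(2)[of "k - 1"]] by (simp add: Z(4))
  ultimately have seq: "\<forall>k. (G (i k), G (p k)) \<in> SES D \<and> G (i k) \<in> Hom D (F (Z k)) (F (N k)) \<and>
      G (p k) \<in> Hom D (F (N k)) (F (Z (k - 1))) \<and> (G \<circ> d) k = G (i (k - 1)) \<cdot>\<^bsub>D\<^esub> G (p k)"
    and bd': "bounded_complex D (F \<circ> N) (G \<circ> d)"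
    using Z by simp_all
  show ?thesis
    unfolding acyclic_complex_def
    by (rule conjI[OF bd'], rule exI[of _ "F \<circ> Z"], rule exI[of _ "G \<circ> i"],
      rule exI[of _ "G \<circ> p"]) (use seq in simp)
qed

lemma exact_functor_base_cat:
  assumes "exact_functor C D F G"
  shows "exact_functor (base_cat C) (base_cat D) (map_mobj F G) (map_mmor F G)"
  unfolding exact_functor_def
  by (auto simp: Hom_base_cat exact_functorD[OF assms])

text \<open>Membership in \<open>Bq_objs C\<close> guarantees the constructor \<open>Cx\<close>. On
  a \<open>Base_obj\<close> the selectors are unspecified, so they are not known to commute with the
  map.\<close>

lemma gr_map_mobj:
  assumes "X \<in> Bq_objs C"
  shows "gr (map_mobj F G X) k = map_mobj F G (gr X k)"
    "dff (map_mobj F G X) k = map_mmor F G (dff X k)"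
    "dff' (map_mobj F G X) k = map_mmor F G (dff' X k)"
  using assms by (auto simp: Bq_objs_def)

lemma cpt_map_mmor:
  assumes "f \<in> Bq_arrs C"
  shows "cpt (map_mmor F G f) k = map_mmor F G (cpt f k)"
    "src (map_mmor F G f) = map_mobj F G (src f)"
    "tgt (map_mmor F G f) = map_mobj F G (tgt f)"
  using assms by (auto simp: Bq_arrs_def)

text \<open>The same two functions occur in hypothesis and conclusion: on a \<open>Cx\<close>,
  \<open>map_mobj F G\<close> applies itself to each entry and \<open>map_mmor F G\<close> to each
  differential. So the recursive map already is the termwise extension of the functor one level
  below, and this lemma is an induction step as it stands.\<close>

lemma exact_functor_Bq:
  fixes C :: "('o, 'm) mcat" and D :: "('p, 'n) mcat"
  assumes C: "pointed_category C" and D: "pointed_category D"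
    and F: "exact_functor C D (map_mobj F G) (map_mmor F G)"
  shows "exact_functor (Bq C) (Bq D) (map_mobj F G) (map_mmor F G)"
proof -
  note FD = exact_functorD[OF F]
  have obj: "map_mobj F G X \<in> Bq_objs D" if "X \<in> Bq_objs C" for X
    using that exact_functor_acyclic_complex[OF C D F] by (auto simp: Bq_objs_def)
  have hom: "map_mmor F G f \<in> Hom (Bq D) (map_mobj F G X) (map_mobj F G Y)"
    if f: "f \<in> Hom (Bq C) X Y" for f X Y
  proof -
    have X: "X \<in> Bq_objs C" and Y: "Y \<in> Bq_objs C" and fe: "f = Cx_mor X Y (cpt f)"
      and fk: "\<And>k. cpt f k \<in> Hom C (gr X k) (gr Y k)"
      and eq: "\<And>k. cpt f (k - 1) \<cdot>\<^bsub>C\<^esub> dff X k = dff Y k \<cdot>\<^bsub>C\<^esub> cpt f k"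
      "\<And>k. cpt f (k - 1) \<cdot>\<^bsub>C\<^esub> dff' X k = dff' Y k \<cdot>\<^bsub>C\<^esub> cpt f k"
      using f by (auto simp: Hom_Bq)
    have fa: "f \<in> Bq_arrs C" using HomD[OF f] by simp
    have "map_mmor F G f = Cx_mor (map_mobj F G X) (map_mobj F G Y) (cpt (map_mmor F G f))"
      by (subst (1 2) fe) (simp add: comp_def)
    then show ?thesis
      unfolding Hom_Bq
      using obj[OF X] obj[OF Y] FD(2)[OF fk]
        FD(4)[OF Bq_objsD(5)[OF X] fk] FD(4)[OF fk Bq_objsD(5)[OF Y]]
        FD(4)[OF Bq_objsD(6)[OF X] fk] FD(4)[OF fk Bq_objsD(6)[OF Y]]
      by (simp add: gr_map_mobj[OF X] gr_map_mobj[OF Y] cpt_map_mmor[OF fa] eq flip: FD(4))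
  qed
  have arr: "map_mmor F G f \<in> Bq_arrs D" if "f \<in> Bq_arrs C" for f
    using hom[of f "src f" "tgt f"] that by (simp add: Hom_def)
  show ?thesis
    unfolding exact_functor_def
  proof (intro conjI ballI allI)
    fix X assume X: "X \<in> Obj (Bq C)"
    then show "map_mobj F G X \<in> Obj (Bq D)" using obj by simp
    show "map_mmor F G (Ide (Bq C) X) = Ide (Bq D) (map_mobj F G X)"
      using X Bq_objsD(4)[of X C] by (simp add: gr_map_mobj comp_def FD)
    fix Y assume Y: "Y \<in> Obj (Bq C)"
    show "map_mmor F G (Zero (Bq C) X Y) = Zero (Bq D) (map_mobj F G X) (map_mobj F G Y)"
      using X Y Bq_objsD(4)[of X C] Bq_objsD(4)[of Y C] by (simp add: gr_map_mobj comp_def FD)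
  next
    fix X Y f assume "f \<in> Hom (Bq C) X Y"
    then show "map_mmor F G f \<in> Hom (Bq D) (map_mobj F G X) (map_mobj F G Y)" by (rule hom)
  next
    fix X Y Z f g assume f: "f \<in> Hom (Bq C) X Y" and g: "g \<in> Hom (Bq C) Y Z"
    have fg: "cpt f k \<in> Hom C (gr X k) (gr Y k)" "cpt g k \<in> Hom C (gr Y k) (gr Z k)" for k
      using f g by (auto simp: Hom_Bq)
    have "f \<in> Bq_arrs C" "g \<in> Bq_arrs C" using f g by (auto simp: Hom_def)
    then show "map_mmor F G (g \<cdot>\<^bsub>Bq C\<^esub> f) = map_mmor F G g \<cdot>\<^bsub>Bq D\<^esub> map_mmor F G f"
      by (simp add: cpt_map_mmor comp_def FD(4)[OF fg])
  next
    fix ip assume "ip \<in> SES (Bq C)"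
    then show "case ip of (i, p) \<Rightarrow> (map_mmor F G i, map_mmor F G p) \<in> SES (Bq D)"
      by (auto simp: arr cpt_map_mmor FD(6))
  qed
qed

lemma exact_functor_Bq_pow:
  assumes "pointed_category C" "pointed_category D" "exact_functor C D F G"
  shows "exact_functor (Bq_pow n C) (Bq_pow n D) (map_mobj F G) (map_mmor F G)"
  by (induction n)
    (simp_all add: assms exact_functor_base_cat exact_functor_Bq pointed_category_Bq_pow)

text \<open>Identities such as s i = id hold on \<open>Obj\<close> and \<open>Arr\<close> only,
  while the functions are total. They transfer to multicomplexes because every leaf of an object or
  arrow of \<open>Bq_pow n C\<close> is an object or arrow of C. The two claims need each other: an
  object contains its differentials, and a morphism contains its source and target.\<close>

lemma map_mobj_cong_Bq_pow:
  assumes "\<And>X. X \<in> Obj C \<Longrightarrow> F X = F' X" "\<And>f. f \<in> Arr C \<Longrightarrow> G f = G' f"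
  shows "X \<in> Obj (Bq_pow n C) \<Longrightarrow> map_mobj F G X = map_mobj F' G' X"
    and "f \<in> Arr (Bq_pow n C) \<Longrightarrow> map_mmor F G f = map_mmor F' G' f"
proof (induction n arbitrary: X f)
  case 0
  { case 1 then show ?case using assms by auto }
  { case 2 then show ?case using assms by auto }
next
  case (Suc n)
  have obj: "map_mobj F G X = map_mobj F' G' X" if "X \<in> Bq_objs (Bq_pow n C)" for X
  proof -
    \<comment> \<open>X is displayed as a \<open>Cx\<close>, so that one layer of the map unfolds
      and the induction hypothesis reaches the entries and both differentials.\<close>
    have "map_mobj F G (Cx (gr X) (dff X) (dff' X)) = map_mobj F' G' (Cx (gr X) (dff X) (dff' X))"
      using Suc.IH Bq_objsD(4-6)[OF that] by (simp add: comp_def Hom_def)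
    then show ?thesis by (simp flip: Bq_objsD(1)[OF that])
  qed
  { case 1 then show ?case using obj by simp }
  { case 2
    then obtain X Y h where f: "f = Cx_mor X Y h" "X \<in> Bq_objs (Bq_pow n C)"
      "Y \<in> Bq_objs (Bq_pow n C)" "\<And>k. h k \<in> Arr (Bq_pow n C)"
      by (auto simp: Bq_arrs_def Hom_def)
    then show ?case using obj Suc.IH by (simp add: comp_def) }
qed

lemma diagonal_in_map_mobj: "diagonal_in i X \<Longrightarrow> diagonal_in i (map_mobj F G X)"
  by (induction i X rule: diagonal_in.induct) auto

section \<open>Natural short exact sequences of functors\<close>

definition natural_ses :: "('o, 'm) exact_data \<Rightarrow> ('p, 'n) exact_data \<Rightarrow>
    ('o \<Rightarrow> 'p) \<Rightarrow> ('m \<Rightarrow> 'n) \<Rightarrow> ('o \<Rightarrow> 'p) \<Rightarrow> ('m \<Rightarrow> 'n) \<Rightarrow> ('o \<Rightarrow> 'p) \<Rightarrow> ('m \<Rightarrow> 'n) \<Rightarrow> bool" where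
  "natural_ses C D F' G' F G F'' G'' \<longleftrightarrow> (\<exists>\<alpha> \<beta>.
     (\<forall>X \<in> Obj C. \<alpha> X \<in> Hom D (F' X) (F X) \<and> \<beta> X \<in> Hom D (F X) (F'' X) \<and> (\<alpha> X, \<beta> X) \<in> SES D) \<and>
     (\<forall>X Y. \<forall>f \<in> Hom C X Y. \<alpha> Y \<cdot>\<^bsub>D\<^esub> G' f = G f \<cdot>\<^bsub>D\<^esub> \<alpha> X \<and> \<beta> Y \<cdot>\<^bsub>D\<^esub> G f = G'' f \<cdot>\<^bsub>D\<^esub> \<beta> X))"

lemma natural_ses_base_cat:
  assumes "natural_ses C D F' G' F G F'' G''"
  shows "natural_ses (base_cat C) (base_cat D) (map_mobj F' G') (map_mmor F' G')
    (map_mobj F G) (map_mmor F G) (map_mobj F'' G'') (map_mmor F'' G'')"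
proof -
  from assms obtain \<alpha> \<beta> where ses: "\<And>X. X \<in> Obj C \<Longrightarrow> \<alpha> X \<in> Hom D (F' X) (F X) \<and> \<beta> X \<in> Hom D (F X) (F'' X) \<and> (\<alpha> X, \<beta> X) \<in> SES D"
    and nat: "\<And>X Y f. f \<in> Hom C X Y \<Longrightarrow> \<alpha> Y \<cdot>\<^bsub>D\<^esub> G' f = G f \<cdot>\<^bsub>D\<^esub> \<alpha> X \<and> \<beta> Y \<cdot>\<^bsub>D\<^esub> G f = G'' f \<cdot>\<^bsub>D\<^esub> \<beta> X"
    unfolding natural_ses_def by blast
  show ?thesis
    unfolding natural_ses_def
  proof (rule exI[of _ "\<lambda>X. Base_mor (\<alpha> (base_obj X))"], rule exI[of _ "\<lambda>X. Base_mor (\<beta> (base_obj X))"],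
      intro conjI ballI allI)
  qed (use ses nat in \<open>force simp: Hom_base_cat\<close>)+
qed

text \<open>The new transformations consist of \<open>\<alpha>\<close> and \<open>\<beta>\<close> at
  the entries of a complex. Naturality of the old ones at \<open>dff X k\<close> and
  \<open>dff' X k\<close> says exactly that these families commute with both differentials.
  Exactness is termwise by definition of \<open>Bq\<close>.\<close>

lemma natural_ses_Bq:
  fixes C :: "('o, 'm) mcat" and D :: "('p, 'n) mcat"
  assumes C: "pointed_category C" and D: "pointed_category D"
    and F': "exact_functor C D (map_mobj F' G') (map_mmor F' G')"
    and F: "exact_functor C D (map_mobj F G) (map_mmor F G)"
    and F'': "exact_functor C D (map_mobj F'' G'') (map_mmor F'' G'')"
    and ses: "natural_ses C D (map_mobj F' G') (map_mmor F' G')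
      (map_mobj F G) (map_mmor F G) (map_mobj F'' G'') (map_mmor F'' G'')"
  shows "natural_ses (Bq C) (Bq D) (map_mobj F' G') (map_mmor F' G')
    (map_mobj F G) (map_mmor F G) (map_mobj F'' G'') (map_mmor F'' G'')"
proof -
  from ses obtain \<alpha> \<beta> where
    ses: "\<And>X. X \<in> Obj C \<Longrightarrow> \<alpha> X \<in> Hom D (map_mobj F' G' X) (map_mobj F G X) \<and>
      \<beta> X \<in> Hom D (map_mobj F G X) (map_mobj F'' G'' X) \<and> (\<alpha> X, \<beta> X) \<in> SES D"
    and nat: "\<And>X Y f. f \<in> Hom C X Y \<Longrightarrow> \<alpha> Y \<cdot>\<^bsub>D\<^esub> map_mmor F' G' f = map_mmor F G f \<cdot>\<^bsub>D\<^esub> \<alpha> X \<and>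
      \<beta> Y \<cdot>\<^bsub>D\<^esub> map_mmor F G f = map_mmor F'' G'' f \<cdot>\<^bsub>D\<^esub> \<beta> X"
    unfolding natural_ses_def by blast
  define \<alpha>' where "\<alpha>' X = Cx_mor (map_mobj F' G' X) (map_mobj F G X) (\<lambda>k. \<alpha> (gr X k))" for X
  define \<beta>' where "\<beta>' X = Cx_mor (map_mobj F G X) (map_mobj F'' G'' X) (\<lambda>k. \<beta> (gr X k))" for X
  have obj: "map_mobj F' G' X \<in> Bq_objs D" "map_mobj F G X \<in> Bq_objs D"
    "map_mobj F'' G'' X \<in> Bq_objs D" if "X \<in> Bq_objs C" for X
    using that exact_functor_Bq[OF C D F'] exact_functor_Bq[OF C D F] exact_functor_Bq[OF C D F'']
    by (auto dest: exact_functorD(1))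
  have hom: "\<alpha>' X \<in> Hom (Bq D) (map_mobj F' G' X) (map_mobj F G X)"
    "\<beta>' X \<in> Hom (Bq D) (map_mobj F G X) (map_mobj F'' G'' X)" if X: "X \<in> Bq_objs C" for X
    using obj[OF X] ses[OF Bq_objsD(4)[OF X]] nat[OF Bq_objsD(5)[OF X]] nat[OF Bq_objsD(6)[OF X]]
    by (simp_all add: Hom_Bq \<alpha>'_def \<beta>'_def gr_map_mobj[OF X])
  show ?thesis
    unfolding natural_ses_def
  proof (rule exI[of _ \<alpha>'], rule exI[of _ \<beta>'], intro conjI ballI allI)
    fix X assume "X \<in> Obj (Bq C)"
    then have X: "X \<in> Bq_objs C" by simp
    show "\<alpha>' X \<in> Hom (Bq D) (map_mobj F' G' X) (map_mobj F G X)"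
      and "\<beta>' X \<in> Hom (Bq D) (map_mobj F G X) (map_mobj F'' G'' X)" using hom[OF X] by auto
    then have "\<alpha>' X \<in> Bq_arrs D" "\<beta>' X \<in> Bq_arrs D" by (auto dest: HomD)
    then show "(\<alpha>' X, \<beta>' X) \<in> SES (Bq D)"
      using ses[OF Bq_objsD(4)[OF X]] by (simp add: \<alpha>'_def \<beta>'_def)
  next
    fix X Y f assume f: "f \<in> Hom (Bq C) X Y"
    have fk: "\<And>k. cpt f k \<in> Hom C (gr X k) (gr Y k)"
      using f by (simp add: Hom_Bq)
    have st: "src f = X" "tgt f = Y" and fa: "f \<in> Bq_arrs C"
      using HomD[OF f] by auto
    show "\<alpha>' Y \<cdot>\<^bsub>Bq D\<^esub> map_mmor F' G' f = map_mmor F G f \<cdot>\<^bsub>Bq D\<^esub> \<alpha>' X"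
      "\<beta>' Y \<cdot>\<^bsub>Bq D\<^esub> map_mmor F G f = map_mmor F'' G'' f \<cdot>\<^bsub>Bq D\<^esub> \<beta>' X"
      using nat[OF fk] by (simp_all add: \<alpha>'_def \<beta>'_def cpt_map_mmor[OF fa] st)
  qed
qed

lemma natural_ses_Bq_pow:
  assumes "pointed_category C" "pointed_category D"
    "exact_functor C D F' G'" "exact_functor C D F G" "exact_functor C D F'' G''"
    "natural_ses C D F' G' F G F'' G''"
  shows "natural_ses (Bq_pow n C) (Bq_pow n D) (map_mobj F' G') (map_mmor F' G')
    (map_mobj F G) (map_mmor F G) (map_mobj F'' G'') (map_mmor F'' G'')"
  by (induction n)
    (simp_all add: assms natural_ses_base_cat natural_ses_Bq exact_functor_Bq_pow
      pointed_category_Bq_pow)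


section \<open>K-groups\<close>

lemma exact_functor_id: "exact_functor C C id id"
  by (auto simp: exact_functor_def)

lemma exact_functor_comp:
  assumes "exact_functor C D F G" "exact_functor D E F' G'"
  shows "exact_functor C E (F' \<circ> F) (G' \<circ> G)"
  unfolding exact_functor_def
  by (auto simp: exact_functorD[OF assms(1)] exact_functorD[OF assms(2)]
      exact_functorD(4)[OF assms(2) exact_functorD(2)[OF assms(1)] exact_functorD(2)[OF assms(1)]]
      exact_functorD(4)[OF assms(1)])

section \<open>Free groups on multicomplexes modulo the defining relations\<close>

abbreviation free_K :: "nat \<Rightarrow> ('o, 'm) exact_data \<Rightarrow> (('o, 'm) mobj \<Rightarrow>\<^sub>0 int) monoid" where
  "free_K n N \<equiv> free_Abelian_group (Obj (Bq_pow n N))"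

abbreviation null_K :: "nat \<Rightarrow> ('o, 'm) exact_data \<Rightarrow> (('o, 'm) mobj \<Rightarrow>\<^sub>0 int) set" where
  "null_K n N \<equiv> generate (free_K n N) (K_relations n N)"

definition K_class :: "nat \<Rightarrow> ('o, 'm) exact_data \<Rightarrow>
    (('o, 'm) mobj \<Rightarrow>\<^sub>0 int) \<Rightarrow> (('o, 'm) mobj \<Rightarrow>\<^sub>0 int) set" where
  "K_class n N x = null_K n N #>\<^bsub>free_K n N\<^esub> x"

text \<open>The linear map of free groups that induces K(F). The induced map on quotients is never
  formed; its properties are stated modulo \<open>null_K\<close>.\<close>

definition frag_map ::
  "('o \<Rightarrow> 'p) \<Rightarrow> ('m \<Rightarrow> 'n) \<Rightarrow> (('o, 'm) mobj \<Rightarrow>\<^sub>0 int) \<Rightarrow> (('p, 'n) mobj \<Rightarrow>\<^sub>0 int)" where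
  "frag_map F G = frag_extend (frag_of \<circ> map_mobj F G)"

lemma free_Abelian_group_diff_closed:
  assumes "a \<in> carrier (free_Abelian_group S)" "b \<in> carrier (free_Abelian_group S)"
  shows "a - b \<in> carrier (free_Abelian_group S)"
  using assms keys_diff[of a b] by auto

lemma free_Abelian_group_add_closed:
  assumes "a \<in> carrier (free_Abelian_group S)" "b \<in> carrier (free_Abelian_group S)"
  shows "a + b \<in> carrier (free_Abelian_group S)"
  using assms keys_add[of a b] by auto

lemma SES_Obj:
  assumes "pointed_category C" "(i, p) \<in> SES C"
  shows "Dom C i \<in> Obj C" "Cod C i \<in> Obj C" "Cod C p \<in> Obj C"
proof -
  interpret pointed_category C by fact
  show "Dom C i \<in> Obj C" "Cod C i \<in> Obj C" "Cod C p \<in> Obj C"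
    using SES_composable[OF assms(2)] Dom_in_Obj Cod_in_Obj by auto
qed

lemma K_relations_closed:
  assumes "pointed_category N"
  shows "K_relations n N \<subseteq> carrier (free_K n N)"
proof
  fix x assume "x \<in> K_relations n N"
  then consider i p where "(i, p) \<in> SES (Bq_pow n N)"
      "x = frag_of (Dom (Bq_pow n N) i) + frag_of (Cod (Bq_pow n N) p) - frag_of (Cod (Bq_pow n N) i)"
    | T where "T \<in> Obj (Bq_pow n N)" "x = frag_of T"
    unfolding K_relations_def by blast
  then show "x \<in> carrier (free_K n N)"
  proof cases
    case 1
    then show ?thesis
      using SES_Obj[OF pointed_category_Bq_pow[OF assms] 1(1)]
      by (simp only: free_Abelian_group_diff_closed free_Abelian_group_add_closed
          frag_of_in_free_Abelian_group)
  next
    case 2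
    then show ?thesis by simp
  qed
qed

lemma subgroup_free_Abelian_group_diff:
  assumes "subgroup H (free_Abelian_group S)" "a \<in> H" "b \<in> H"
  shows "a - b \<in> H"
proof -
  interpret subgroup H "free_Abelian_group S" by fact
  have "b \<in> carrier (free_Abelian_group S)" using assms(3) by (rule mem_carrier)
  then have "- b \<in> H" using m_inv_closed[OF assms(3)] by simp
  then show ?thesis using m_closed[OF assms(2)] by fastforce
qed

lemma subgroup_null_K:
  assumes "pointed_category N"
  shows "subgroup (null_K n N) (free_K n N)"
  using group.generate_is_subgroup[OF group_free_Abelian_group K_relations_closed[OF assms]] .

lemma normal_null_K:
  assumes "pointed_category N"
  shows "null_K n N \<lhd> free_K n N"
  using comm_group.normal_iff_subgroup[OF abelian_free_Abelian_group] subgroup_null_K[OF assms] by blast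

lemma group_K_group: "pointed_category N \<Longrightarrow> group (K_group n N)"
  unfolding K_group_def using normal.factorgroup_is_group[OF normal_null_K] .

lemma K_class_hom:
  "pointed_category N \<Longrightarrow> K_class n N \<in> hom (free_K n N) (K_group n N)"
  unfolding K_group_def K_class_def[abs_def] using normal.r_coset_hom_Mod[OF normal_null_K] .

lemma K_class_eq_one_iff:
  assumes "pointed_category N" "x \<in> carrier (free_K n N)"
  shows "K_class n N x = \<one>\<^bsub>K_group n N\<^esub> \<longleftrightarrow> x \<in> null_K n N"
  using group.coset_join1[OF group_free_Abelian_group _ assms(2) subgroup_null_K[OF assms(1)]]
    group.coset_join2[OF group_free_Abelian_group assms(2) subgroup_null_K[OF assms(1)]]
  unfolding K_class_def K_group_def FactGroup_def by auto

lemma K_class_surj: "K_class n N ` carrier (free_K n N) = carrier (K_group n N)"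
  by (auto simp: K_class_def K_group_def FactGroup_def RCOSETS_def simp del: carrier_free_Abelian_group_iff)

lemma frag_map_diff: "frag_map F G (x - y) = frag_map F G x - frag_map F G y"
  and frag_map_add: "frag_map F G (x + y) = frag_map F G x + frag_map F G y"
  and frag_map_of: "frag_map F G (frag_of X) = frag_of (map_mobj F G X)"
  and frag_map_0: "frag_map F G 0 = 0"
  by (simp_all add: frag_map_def frag_extend_diff frag_extend_add)

lemma frag_map_id: "frag_map id id x = x"
  by (simp add: frag_map_def mobj.map_id0 frag_expansion[symmetric])

lemma frag_map_comp: "frag_map F G (frag_map F' G' x) = frag_map (F \<circ> F') (G \<circ> G') x"
  unfolding frag_map_def frag_extend_compose by (simp add: comp_def mobj.map_comp)

lemma frag_map_cong:
  assumes "\<And>X. X \<in> Obj C \<Longrightarrow> F X = F' X" "\<And>f. f \<in> Arr C \<Longrightarrow> G f = G' f"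
    and "x \<in> carrier (free_K n C)"
  shows "frag_map F G x = frag_map F' G' x"
  unfolding frag_map_def
  using assms map_mobj_cong_Bq_pow(1)[of C F F' G G' _ n]
  by (intro frag_extend_eq) auto

lemma frag_map_closed:
  assumes "pointed_category C" "pointed_category D" "exact_functor C D F G"
    and "x \<in> carrier (free_K n C)"
  shows "frag_map F G x \<in> carrier (free_K n D)"
  using keys_frag_extend[of "frag_of \<circ> map_mobj F G" x] assms(4)
    exact_functorD(1)[OF exact_functor_Bq_pow[OF assms(1-3), of n]]
  by (fastforce simp: frag_map_def)

lemma frag_map_hom:
  assumes "pointed_category C" "pointed_category D" "exact_functor C D F G"
  shows "frag_map F G \<in> hom (free_K n C) (free_K n D)"
  using frag_map_closed[OF assms, of _ n] by (intro homI) (simp_all add: frag_map_add)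

text \<open>Well-definedness of K(F): a relation goes to a relation of the same kind, since the
  lifted functor preserves short exact sequences and equality of two differentials in any direction.
  The rest is induction over the generated subgroup.\<close>

lemma frag_map_null:
  assumes C: "pointed_category C" and D: "pointed_category D" and F: "exact_functor C D F G"
    and x: "x \<in> null_K n C"
  shows "frag_map F G x \<in> null_K n D"
proof -
  note Fn = exact_functor_Bq_pow[OF C D F, of n]
  have rel: "frag_map F G h \<in> null_K n D" if h: "h \<in> K_relations n C" for h
  proof (rule generate.incl)
    from h consider i p where "(i, p) \<in> SES (Bq_pow n C)"
        "h = frag_of (Dom (Bq_pow n C) i) + frag_of (Cod (Bq_pow n C) p) - frag_of (Cod (Bq_pow n C) i)"
      | T where "T \<in> Obj (Bq_pow n C)" "h = frag_of T" "diagonal n T"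
      unfolding K_relations_def by blast
    then show "frag_map F G h \<in> K_relations n D"
    proof cases
      case 1
      have arr: "i \<in> Arr (Bq_pow n C)" "p \<in> Arr (Bq_pow n C)"
        using 1(1) pointed_category.SES_composable[OF pointed_category_Bq_pow[OF C]] by blast+
      have ends: "Dom (Bq_pow n D) (map_mmor F G f) = map_mobj F G (Dom (Bq_pow n C) f)"
        "Cod (Bq_pow n D) (map_mmor F G f) = map_mobj F G (Cod (Bq_pow n C) f)"
        if "f \<in> Arr (Bq_pow n C)" for f
        using exact_functorD(2)[OF Fn HomI[OF that refl refl]] by (auto dest: HomD)
      show ?thesis
        unfolding K_relations_def 1(2)
        by (rule UnI1, rule CollectI, rule exI[of _ "map_mmor F G i"], rule exI[of _ "map_mmor F G p"])
          (simp add: exact_functorD(6)[OF Fn 1(1)] ends arr frag_map_diff frag_map_add frag_map_of)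
    next
      case 2
      then have "diagonal n (map_mobj F G T)"
        using diagonal_in_map_mobj unfolding diagonal_def by blast
      then show ?thesis
        using 2 exact_functorD(1)[OF Fn] unfolding K_relations_def by (auto simp: frag_map_of)
    qed
  qed
  have zero: "frag_map F G 0 \<in> null_K n D"
    using generate.one[of "free_K n D"] by (simp add: frag_map_0)
  show ?thesis
    using x
  proof (induction rule: generate.induct)
    case one
    then show ?case using zero by simp
  next
    case (incl h)
    then show ?case by (rule rel)
  next
    case (inv h)
    \<comment> \<open>The inverse is written as a difference, the form that
      \<open>frag_map_diff\<close> transports.\<close>
    then have "inv\<^bsub>free_K n C\<^esub> h = 0 - h"
      using K_relations_closed[OF C, of n] by auto
    then show ?case
      using subgroup_free_Abelian_group_diff[OF subgroup_null_K[OF D] zero rel[OF inv]]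
      by (simp only: frag_map_diff)
  next
    case (eng h1 h2)
    then show ?case
      using subgroup.m_closed[OF subgroup_null_K[OF D, of n]] by (fastforce simp: frag_map_add)
  qed
qed

text \<open>At a generator X the expression is the relation given by the lifted sequence at X. It is
  linear in x, so it stays in the subgroup for every formal sum.\<close>

lemma frag_map_additive:
  assumes C: "pointed_category C" and D: "pointed_category D"
    and F: "exact_functor C D F' G'" "exact_functor C D F G" "exact_functor C D F'' G''"
    and ses: "natural_ses C D F' G' F G F'' G''"
    and x: "x \<in> carrier (free_K n C)"
  shows "frag_map F' G' x + frag_map F'' G'' x - frag_map F G x \<in> null_K n D"
proof -
  have "Poly_Mapping.keys x \<subseteq> Obj (Bq_pow n C)" using x by simp
  then show ?thesis
  proof (induction x rule: frag_induction)
    case zero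
    then show ?case using generate.one[of "free_K n D"] by (simp add: frag_map_0)
  next
    case (one X)
    obtain a b where "a \<in> Hom (Bq_pow n D) (map_mobj F' G' X) (map_mobj F G X)"
      "b \<in> Hom (Bq_pow n D) (map_mobj F G X) (map_mobj F'' G'' X)" "(a, b) \<in> SES (Bq_pow n D)"
      using natural_ses_Bq_pow[OF C D F ses, of n] one unfolding natural_ses_def by blast
    then have "frag_of (map_mobj F' G' X) + frag_of (map_mobj F'' G'' X) - frag_of (map_mobj F G X)
        \<in> K_relations n D"
      unfolding K_relations_def by (intro UnI1) (force dest: HomD)
    then show ?case by (simp add: frag_map_of generate.incl)
  next
    case (diff a b)
    have "frag_map F' G' (a - b) + frag_map F'' G'' (a - b) - frag_map F G (a - b) =
        (frag_map F' G' a + frag_map F'' G'' a - frag_map F G a) -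
        (frag_map F' G' b + frag_map F'' G'' b - frag_map F G b)"
      by (simp add: frag_map_diff algebra_simps)
    then show ?case
      using subgroup_free_Abelian_group_diff[OF subgroup_null_K[OF D] diff] by simp
  qed
qed

text \<open>First isomorphism theorem for the map \<open>h\<close> out of the free group of E:
  \<open>ext\<close> shows that the kernel is no larger than \<open>null_K n E\<close>, and the four
  statements about s i, q j, q i and s j give surjectivity. Since \<open>SI\<close> and
  \<open>QJ\<close> are equalities, s i and q j are the identity on the free groups themselves, and
  only the cross terms have to be killed by relations.\<close>

lemma K_group_iso_DirProd:
  assumes A: "pointed_category A" and E: "pointed_category E" and C: "pointed_category C"
    and S: "exact_functor E A sF sG" and Q: "exact_functor E C qF qG"
    and I: "exact_functor A E iF iG" and J: "exact_functor C E jF jG"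
    and SI: "\<And>X. X \<in> Obj A \<Longrightarrow> sF (iF X) = X" "\<And>f. f \<in> Arr A \<Longrightarrow> sG (iG f) = f"
    and QJ: "\<And>X. X \<in> Obj C \<Longrightarrow> qF (jF X) = X" "\<And>f. f \<in> Arr C \<Longrightarrow> qG (jG f) = f"
    and QI: "natural_ses A C (qF \<circ> iF) (qG \<circ> iG) (qF \<circ> iF) (qG \<circ> iG) (qF \<circ> iF) (qG \<circ> iG)"
    and SJ: "natural_ses C A (sF \<circ> jF) (sG \<circ> jG) (sF \<circ> jF) (sG \<circ> jG) (sF \<circ> jF) (sG \<circ> jG)"
    and ext: "natural_ses E E (iF \<circ> sF) (iG \<circ> sG) id id (jF \<circ> qF) (jG \<circ> qG)"
  shows "K_group n E \<cong> K_group n A \<times>\<times> K_group n C"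
proof -
  let ?s = "frag_map sF sG" and ?q = "frag_map qF qG" and ?i = "frag_map iF iG" and ?j = "frag_map jF jG"
  define h where "h x = (K_class n A (?s x), K_class n C (?q x))" for x
  note closed = frag_map_closed[OF E A S] frag_map_closed[OF E C Q]
    frag_map_closed[OF A E I] frag_map_closed[OF C E J]
  note null = frag_map_null[OF E A S] frag_map_null[OF E C Q]
    frag_map_null[OF A E I] frag_map_null[OF C E J]
  have si: "?s (?i a) = a" if "a \<in> carrier (free_K n A)" for a
    using frag_map_cong[of A "sF \<circ> iF" id "sG \<circ> iG" id, OF _ _ that] SI
    by (simp add: frag_map_comp frag_map_id)
  have qj: "?q (?j c) = c" if "c \<in> carrier (free_K n C)" for c
    using frag_map_cong[of C "qF \<circ> jF" id "qG \<circ> jG" id, OF _ _ that] QJ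
    by (simp add: frag_map_comp frag_map_id)
  have qi: "?q (?i a) \<in> null_K n C" if "a \<in> carrier (free_K n A)" for a
    using frag_map_additive[OF A C _ _ _ QI that] exact_functor_comp[OF I Q]
    by (simp add: frag_map_comp)
  have sj: "?s (?j c) \<in> null_K n A" if "c \<in> carrier (free_K n C)" for c
    using frag_map_additive[OF C A _ _ _ SJ that] exact_functor_comp[OF J S]
    by (simp add: frag_map_comp)
  have split: "?i (?s x) + ?j (?q x) - x \<in> null_K n E" if "x \<in> carrier (free_K n E)" for x
    using frag_map_additive[OF E E exact_functor_comp[OF S I] exact_functor_id
        exact_functor_comp[OF Q J] ext that]
    by (simp add: frag_map_comp frag_map_id)
  interpret A: group_hom "free_K n A" "K_group n A" "K_class n A"
    by (intro group_hom.intro group_hom_axioms.intro K_class_hom group_K_group A) simp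
  interpret C: group_hom "free_K n C" "K_group n C" "K_class n C"
    by (intro group_hom.intro group_hom_axioms.intro K_class_hom group_K_group C) simp
  have "h \<in> hom (free_K n E) (K_group n A \<times>\<times> K_group n C)"
    using hom_compose[OF frag_map_hom[OF E A S] K_class_hom[OF A]]
      hom_compose[OF frag_map_hom[OF E C Q] K_class_hom[OF C]]
    unfolding h_def[abs_def] hom_paired by (simp add: comp_def)
  then interpret h: group_hom "free_K n E" "K_group n A \<times>\<times> K_group n C" h
    by (intro group_hom.intro group_hom_axioms.intro DirProd_group group_K_group A C) simp_all
  have ker: "kernel (free_K n E) (K_group n A \<times>\<times> K_group n C) h = null_K n E"
  proof (intro equalityI subsetI)
    fix x assume "x \<in> kernel (free_K n E) (K_group n A \<times>\<times> K_group n C) h"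
    then have x: "x \<in> carrier (free_K n E)" and "?s x \<in> null_K n A" "?q x \<in> null_K n C"
      using closed K_class_eq_one_iff[OF A] K_class_eq_one_iff[OF C]
      by (auto simp: kernel_def h_def simp del: carrier_free_Abelian_group_iff)
    then have "?i (?s x) \<in> null_K n E" "?j (?q x) \<in> null_K n E"
      using null by blast+
    then have "?i (?s x) + ?j (?q x) \<in> null_K n E"
      using subgroup.m_closed[OF subgroup_null_K[OF E, of n]] by fastforce
    \<comment> \<open>x is the difference of \<open>?i (?s x) + ?j (?q x)\<close> and
      \<open>?i (?s x) + ?j (?q x) - x\<close>, both of which are null.\<close>
    from subgroup_free_Abelian_group_diff[OF subgroup_null_K[OF E] this split[OF x]]
    show "x \<in> null_K n E" by simp
  next
    fix x assume nx: "x \<in> null_K n E"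
    then have "x \<in> carrier (free_K n E)"
      using subgroup.mem_carrier[OF subgroup_null_K[OF E]] by blast
    then show "x \<in> kernel (free_K n E) (K_group n A \<times>\<times> K_group n C) h"
      using closed null nx K_class_eq_one_iff[OF A] K_class_eq_one_iff[OF C]
      by (auto simp: kernel_def h_def simp del: carrier_free_Abelian_group_iff)
  qed
  have "h ` carrier (free_K n E) = carrier (K_group n A \<times>\<times> K_group n C)"
  proof (intro equalityI subsetI)
    fix y assume "y \<in> carrier (K_group n A \<times>\<times> K_group n C)"
    then obtain a c where a: "a \<in> carrier (free_K n A)" and c: "c \<in> carrier (free_K n C)"
      and y: "y = (K_class n A a, K_class n C c)"
      by (auto simp flip: K_class_surj simp del: carrier_free_Abelian_group_iff)
    let ?x = "?i a + ?j c"
    have x: "?x \<in> carrier (free_K n E)"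
      using closed(3)[OF a] closed(4)[OF c] free_Abelian_group_add_closed by blast
    \<comment> \<open>\<open>?s ?x\<close> is a plus the cross term \<open>?s (?j c)\<close>, whose
      class is trivial by \<open>sj\<close>. For \<open>?q ?x\<close> the cross term is
      \<open>?q (?i a)\<close>, killed by \<open>qi\<close>.\<close>
    have "K_class n A (a + ?s (?j c)) = K_class n A a"
      using A.hom_mult[OF a closed(1)[OF closed(4)[OF c]]] K_class_eq_one_iff[OF A closed(1)[OF closed(4)[OF c]]]
        sj[OF c] A.hom_closed[OF a] by simp
    moreover have "K_class n C (?q (?i a) + c) = K_class n C c"
      using C.hom_mult[OF closed(2)[OF closed(3)[OF a]] c] K_class_eq_one_iff[OF C closed(2)[OF closed(3)[OF a]]]
        qi[OF a] C.hom_closed[OF c] by simp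
    ultimately have "h ?x = y"
      by (simp only: h_def y frag_map_add si[OF a] qj[OF c])
    then show "y \<in> h ` carrier (free_K n E)" using x by blast
  qed (use h.hom_closed in blast)
  \<comment> \<open>With the kernel rewritten to \<open>null_K n E\<close>, the quotient is
    \<open>K_group n E\<close> by definition.\<close>
  from h.FactGroup_iso[OF this] show ?thesis
    unfolding ker K_group_def[of n E] .
qed

section \<open>The extension category\<close>

lemma full_subcat_simps [simp]:
  "Obj (full_subcat C S) = S" "Arr (full_subcat C S) = {f \<in> Arr C. Dom C f \<in> S \<and> Cod C f \<in> S}"
  "Dom (full_subcat C S) = Dom C" "Cod (full_subcat C S) = Cod C"
  "Ide (full_subcat C S) = Ide C" "Comp (full_subcat C S) = Comp C" "Zero (full_subcat C S) = Zero C"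
  "SES (full_subcat C S) = {(i, p) \<in> SES C. Dom C i \<in> S \<and> Cod C i \<in> S \<and> Cod C p \<in> S}"
  by (simp_all add: full_subcat_def)

lemma Hom_full_subcat: "f \<in> Hom (full_subcat C S) X Y \<longleftrightarrow> f \<in> Hom C X Y \<and> X \<in> S \<and> Y \<in> S"
  by (auto simp: Hom_def)

lemma ext_cat_simps [simp]:
  "Obj (ext_cat SA B SC) = ext_objs B SA SC" "Arr (ext_cat SA B SC) = ext_arrs B SA SC"
  "Dom (ext_cat SA B SC) (X, Y, a, b, c) = X" "Cod (ext_cat SA B SC) (X, Y, a, b, c) = Y"
  "Ide (ext_cat SA B SC) X = (X, X, Ide B (Dom B (fst X)), Ide B (Cod B (fst X)), Ide B (Cod B (snd X)))"
  "Comp (ext_cat SA B SC) (Y, Z, a', b', c') (X, Y', a, b, c) =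
    (X, Z, a' \<cdot>\<^bsub>B\<^esub> a, b' \<cdot>\<^bsub>B\<^esub> b, c' \<cdot>\<^bsub>B\<^esub> c)"
  "Zero (ext_cat SA B SC) X Y = (X, Y, Zero B (Dom B (fst X)) (Dom B (fst Y)),
     Zero B (Cod B (fst X)) (Cod B (fst Y)), Zero B (Cod B (snd X)) (Cod B (snd Y)))"
  "((X, Y, a, b, c), (Y', Z, a', b', c')) \<in> SES (ext_cat SA B SC) \<longleftrightarrow> Y' = Y \<and>
     (X, Y, a, b, c) \<in> ext_arrs B SA SC \<and> (Y, Z, a', b', c') \<in> ext_arrs B SA SC \<and>
     (a, a') \<in> SES (full_subcat B SA) \<and> (b, b') \<in> SES B \<and> (c, c') \<in> SES (full_subcat B SC)"
  by (auto simp: ext_cat_def split_beta) (cases X; cases Y; cases Z; auto)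

lemma Hom_ext_cat: "f \<in> Hom (ext_cat SA B SC) X Y \<longleftrightarrow> (\<exists>a b c. f = (X, Y, a, b, c) \<and>
    X \<in> ext_objs B SA SC \<and> Y \<in> ext_objs B SA SC \<and>
    a \<in> Hom B (Dom B (fst X)) (Dom B (fst Y)) \<and> b \<in> Hom B (Cod B (fst X)) (Cod B (fst Y)) \<and>
    c \<in> Hom B (Cod B (snd X)) (Cod B (snd Y)) \<and>
    b \<cdot>\<^bsub>B\<^esub> fst X = fst Y \<cdot>\<^bsub>B\<^esub> a \<and> c \<cdot>\<^bsub>B\<^esub> snd X = snd Y \<cdot>\<^bsub>B\<^esub> b)"
  by (cases f; cases X; cases Y) (auto simp: Hom_def[of "ext_cat SA B SC"] ext_arrs_def)

lemma ext_arrs_iff: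
  "(X, Y, a, b, c) \<in> ext_arrs B SA SC \<longleftrightarrow> (X, Y, a, b, c) \<in> Hom (ext_cat SA B SC) X Y"
  by (simp add: Hom_def)

lemma (in exact_category) pointed_category: "pointed_category C"
  using pointed_categoryI SES_kernel by (simp add: is_kernel_def)

lemma pointed_category_full_subcat:
  assumes "exact_category B" "exact_subcategory B S"
  shows "pointed_category (full_subcat B S)"
proof -
  interpret B: exact_category B by fact
  interpret P: pointed_category B by (rule B.pointed_category)
  interpret S: additive_category "full_subcat B S"
    using assms(2) by (simp add: exact_subcategory_def)
  show ?thesis
    using P.SES_composable by (intro S.pointed_categoryI) auto
qed

text \<open>Additivity of the subcategory supplies the zero object. It is recorded by an equation
  because this reads the same in \<open>B\<close>, while the universal property in the subcategory
  only tests against objects of S.\<close>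

lemma exact_subcategory_zero:
  assumes "exact_category B" "exact_subcategory B S"
  obtains Z where "Z \<in> S" "Ide B Z = Zero B Z Z"
proof -
  interpret S: additive_category "full_subcat B S"
    using assms(2) by (simp add: exact_subcategory_def)
  interpret P: pointed_category "full_subcat B S"
    using assms by (rule pointed_category_full_subcat)
  obtain Z where Z: "zero_object (full_subcat B S) Z" using S.ex_zero_object by blast
  then have "Z \<in> S" by (simp add: zero_object_def)
  then show thesis using that P.zero_object_iff Z by simp
qed

text \<open>X is a biproduct of itself with the zero object Z, in either order, and these are the
  two corresponding split sequences.\<close>

lemma (in exact_category) SES_Ide_Zero:
  assumes "X \<in> Obj C" "Z \<in> Obj C" "Ide C Z = Zero C Z Z"
  shows "(Ide C X, Zero C X Z) \<in> SES C" and "(Zero C Z X, Ide C X) \<in> SES C"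
proof -
  interpret pointed_category C by (rule pointed_category)
  note X = assms(1) and Z = assms(2)
  note simps = X Z assms(3) Ide_in_Hom[OF X] Zero_in_Hom[OF X Z] Zero_in_Hom[OF Z X]
    Comp_Ide_left[OF Ide_in_Hom[OF X]] Comp_Ide_left[OF Zero_in_Hom[OF Z X]]
    Comp_Ide_right[OF Zero_in_Hom[OF X Z]] Comp_Zero_left[OF Zero_in_Hom[OF Z X] Z]
    Comp_Zero_left[OF Zero_in_Hom[OF X Z] X] Comp_Zero_left[OF Ide_in_Hom[OF X] Z]
    Comp_Zero_right[OF Z Ide_in_Hom[OF X]]
    Add_Zero_left[OF Ide_in_Hom[OF X]] Add_Zero_right[OF Ide_in_Hom[OF X]]
  have "is_biproduct C X Z X (Ide C X) (Zero C Z X) (Ide C X) (Zero C X Z)"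
    by (simp add: is_biproduct_def simps)
  then show "(Ide C X, Zero C X Z) \<in> SES C" using SES_split X Z by blast
  have "is_biproduct C Z X X (Zero C Z X) (Ide C X) (Zero C X Z) (Ide C X)"
    by (simp add: is_biproduct_def simps)
  then show "(Zero C Z X, Ide C X) \<in> SES C" using SES_split X Z by blast
qed

locale extension_category = exact_category B for B :: "('o, 'm) exact_data" (structure) +
  fixes SA SC :: "'o set"
  assumes SA: "exact_subcategory B SA" and SC: "exact_subcategory B SC"
begin

sublocale pointed_category B
  by (rule pointed_category)

lemma SA_Obj: "X \<in> SA \<Longrightarrow> X \<in> Obj B" and SC_Obj: "X \<in> SC \<Longrightarrow> X \<in> Obj B"
  using SA SC by (auto simp: exact_subcategory_def)

lemma ext_objsD:
  assumes "X \<in> ext_objs B SA SC"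
  shows "fst X \<in> Hom B (Dom B (fst X)) (Cod B (fst X))" "snd X \<in> Hom B (Cod B (fst X)) (Cod B (snd X))"
    "Dom B (fst X) \<in> SA" "Cod B (snd X) \<in> SC" "Cod B (fst X) \<in> Obj B" "(fst X, snd X) \<in> SES B"
    "snd X \<cdot> fst X = Zero B (Dom B (fst X)) (Cod B (snd X))"
proof -
  show ses: "(fst X, snd X) \<in> SES B" and "Dom B (fst X) \<in> SA" "Cod B (snd X) \<in> SC"
    using assms by (auto simp: ext_objs_def)
  show "fst X \<in> Hom B (Dom B (fst X)) (Cod B (fst X))" "snd X \<in> Hom B (Cod B (fst X)) (Cod B (snd X))"
    "Cod B (fst X) \<in> Obj B" "snd X \<cdot> fst X = Zero B (Dom B (fst X)) (Cod B (snd X))"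
    using SES_composable[OF ses] SES_kernel[OF ses] Cod_in_Obj[of "fst X"]
    by (auto intro!: HomI simp: is_kernel_def)
qed

text \<open>The laws hold in each of the three terms. A composite is pasted twice, once over the
  monomorphisms and once over the epimorphisms of the extensions.\<close>

lemma pointed_category_ext_cat: "pointed_category (ext_cat SA B SC)" (is "pointed_category ?E")
proof
  note objD = ext_objsD SA_Obj[OF ext_objsD(3)] SC_Obj[OF ext_objsD(4)]
  fix f X Y g Z h W
  show "f \<in> Arr ?E \<Longrightarrow> Dom ?E f \<in> Obj ?E" "f \<in> Arr ?E \<Longrightarrow> Cod ?E f \<in> Obj ?E"
    by (auto simp: ext_arrs_def)
  show "Ide ?E X \<in> Hom ?E X X" if "X \<in> Obj ?E"
    using objD[of X] that Comp_Ide_left[OF objD(1)] Comp_Ide_right[OF objD(1)]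
      Comp_Ide_left[OF objD(2)] Comp_Ide_right[OF objD(2)]
    by (simp add: Hom_ext_cat Ide_in_Hom)
  show "g \<cdot>\<^bsub>?E\<^esub> f \<in> Hom ?E X Z" if f: "f \<in> Hom ?E X Y" and g: "g \<in> Hom ?E Y Z"
  proof -
    obtain a b c where f: "f = (X, Y, a, b, c)" "X \<in> ext_objs B SA SC" "Y \<in> ext_objs B SA SC"
      and abc: "a \<in> Hom B (Dom B (fst X)) (Dom B (fst Y))" "b \<in> Hom B (Cod B (fst X)) (Cod B (fst Y))"
      "c \<in> Hom B (Cod B (snd X)) (Cod B (snd Y))"
      "b \<cdot> fst X = fst Y \<cdot> a" "c \<cdot> snd X = snd Y \<cdot> b"
      using f unfolding Hom_ext_cat by blast
    obtain a' b' c' where g: "g = (Y, Z, a', b', c')" "Z \<in> ext_objs B SA SC"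
      and abc': "a' \<in> Hom B (Dom B (fst Y)) (Dom B (fst Z))" "b' \<in> Hom B (Cod B (fst Y)) (Cod B (fst Z))"
      "c' \<in> Hom B (Cod B (snd Y)) (Cod B (snd Z))"
      "b' \<cdot> fst Y = fst Z \<cdot> a'" "c' \<cdot> snd Y = snd Z \<cdot> b'"
      using g unfolding Hom_ext_cat by blast
    show ?thesis
      using f g Comp_in_Hom[OF abc(1) abc'(1)] Comp_in_Hom[OF abc(2) abc'(2)] Comp_in_Hom[OF abc(3) abc'(3)]
        Comp_square[OF abc(1) abc'(1) abc(2) abc'(2) objD(1)[OF f(2)] objD(1)[OF f(3)] objD(1)[OF g(2)]
          abc(4) abc'(4)]
        Comp_square[OF abc(2) abc'(2) abc(3) abc'(3) objD(2)[OF f(2)] objD(2)[OF f(3)] objD(2)[OF g(2)]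
          abc(5) abc'(5)]
      by (simp add: Hom_ext_cat)
  qed
  show "f \<in> Hom ?E X Y \<Longrightarrow> f \<cdot>\<^bsub>?E\<^esub> Ide ?E X = f"
    by (auto simp: Hom_ext_cat Comp_Ide_right)
  show "f \<in> Hom ?E X Y \<Longrightarrow> Ide ?E Y \<cdot>\<^bsub>?E\<^esub> f = f"
    by (auto simp: Hom_ext_cat Comp_Ide_left)
  show "\<lbrakk>f \<in> Hom ?E W X; g \<in> Hom ?E X Y; h \<in> Hom ?E Y Z\<rbrakk>
      \<Longrightarrow> h \<cdot>\<^bsub>?E\<^esub> (g \<cdot>\<^bsub>?E\<^esub> f) = h \<cdot>\<^bsub>?E\<^esub> g \<cdot>\<^bsub>?E\<^esub> f"
    by (auto simp: Hom_ext_cat intro!: Comp_assoc)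
  show "Zero ?E X Y \<in> Hom ?E X Y" if "X \<in> Obj ?E" "Y \<in> Obj ?E"
    using that objD[of X] objD[of Y] Comp_Zero_left[OF objD(1)[of X]] Comp_Zero_left[OF objD(2)[of X]]
      Comp_Zero_right[OF _ objD(1)[of Y]] Comp_Zero_right[OF _ objD(2)[of Y]]
    by (simp add: Hom_ext_cat Zero_in_Hom)
  show "g \<cdot>\<^bsub>?E\<^esub> Zero ?E X Y = Zero ?E X Z" if "X \<in> Obj ?E" "g \<in> Hom ?E Y Z"
    using that objD[of X] by (auto simp: Hom_ext_cat intro!: Comp_Zero_right)
  show "Zero ?E Y Z \<cdot>\<^bsub>?E\<^esub> f = Zero ?E X Z" if "f \<in> Hom ?E X Y" "Z \<in> Obj ?E"
    using that objD[of Z] by (auto simp: Hom_ext_cat intro!: Comp_Zero_left)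
  show "(f, g) \<in> SES ?E \<Longrightarrow> f \<in> Arr ?E \<and> g \<in> Arr ?E \<and> Cod ?E f = Dom ?E g"
    by (cases f; cases g) auto
qed

section \<open>Functors between the extension category and the two subcategories\<close>

lemma exact_functor_sub:
  "exact_functor (ext_cat SA B SC) (full_subcat B SA) (\<lambda>X. Dom B (fst X)) (\<lambda>(X, Y, a, b, c). a)"
  unfolding exact_functor_def
  by (auto simp: Hom_ext_cat Hom_full_subcat ext_objs_def)

lemma exact_functor_quot:
  "exact_functor (ext_cat SA B SC) (full_subcat B SC) (\<lambda>X. Cod B (snd X)) (\<lambda>(X, Y, a, b, c). c)"
  unfolding exact_functor_def
  by (auto simp: Hom_ext_cat Hom_full_subcat ext_objs_def)

text \<open>Z is the zero term of the extension and belongs to the opposite subcategory: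
  \<open>from_sub\<close> is used with \<open>ZC\<close> in \<open>SC\<close>, and
  \<open>from_quot\<close> with \<open>ZA\<close> in \<open>SA\<close>.\<close>

definition from_sub :: "'o \<Rightarrow> 'o \<Rightarrow> 'm ext_obj" where
  "from_sub Z X = (Ide B X, Zero B X Z)"

text \<open>On the zero term the component is \<open>Zero B Z Z\<close>, which for a zero object is
  also its identity; hence identities and zero morphisms are both preserved.\<close>

definition from_sub_mor :: "'o \<Rightarrow> 'm \<Rightarrow> 'm ext_mor" where
  "from_sub_mor Z f = (from_sub Z (Dom B f), from_sub Z (Cod B f), f, f, Zero B Z Z)"

definition from_quot :: "'o \<Rightarrow> 'o \<Rightarrow> 'm ext_obj" where
  "from_quot Z X = (Zero B Z X, Ide B X)"

definition from_quot_mor :: "'o \<Rightarrow> 'm \<Rightarrow> 'm ext_mor" where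
  "from_quot_mor Z f = (from_quot Z (Dom B f), from_quot Z (Cod B f), Zero B Z Z, f, f)"

lemma Ide_ends: "X \<in> Obj B \<Longrightarrow> Dom B (Ide B X) = X \<and> Cod B (Ide B X) = X"
  using Ide_in_Hom by (simp add: Hom_def)

lemma Zero_ends: "X \<in> Obj B \<Longrightarrow> Y \<in> Obj B \<Longrightarrow> Dom B (Zero B X Y) = X \<and> Cod B (Zero B X Y) = Y"
  using Zero_in_Hom by (simp add: Hom_def)

context
  fixes ZA ZC :: 'o
  assumes ZA: "ZA \<in> SA" "Ide B ZA = Zero B ZA ZA" and ZC: "ZC \<in> SC" "Ide B ZC = Zero B ZC ZC"
begin

lemma SES_Zero: "(Zero B ZA ZA, Zero B ZA ZA) \<in> SES B" "(Zero B ZC ZC, Zero B ZC ZC) \<in> SES B"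
  using SES_Ide_Zero(1)[of ZA ZA] SES_Ide_Zero(1)[of ZC ZC] ZA ZC SA_Obj SC_Obj by auto

lemma from_sub_Obj: "X \<in> SA \<Longrightarrow> from_sub ZC X \<in> ext_objs B SA SC"
  using SES_Ide_Zero(1) SA_Obj SC_Obj ZC
  by (simp add: from_sub_def ext_objs_def Ide_ends Zero_ends)

lemma from_quot_Obj: "X \<in> SC \<Longrightarrow> from_quot ZA X \<in> ext_objs B SA SC"
  using SES_Ide_Zero(2) SA_Obj SC_Obj ZA
  by (simp add: from_quot_def ext_objs_def Ide_ends Zero_ends)

lemma from_sub_Hom:
  assumes "f \<in> Hom B X Y" "X \<in> SA" "Y \<in> SA"
  shows "from_sub_mor ZC f \<in> Hom (ext_cat SA B SC) (from_sub ZC X) (from_sub ZC Y)"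
  using assms HomD[OF assms(1)] from_sub_Obj[of X] from_sub_Obj[of Y] SA_Obj SC_Obj ZC(1)
    Comp_Ide_left[OF assms(1)] Comp_Ide_right[OF assms(1)] Comp_Zero_left[OF assms(1)]
    Comp_Zero_left[of "Zero B X ZC" X ZC ZC] 
  by (simp add: Hom_ext_cat from_sub_mor_def from_sub_def Ide_ends Zero_ends Zero_in_Hom)

lemma from_quot_Hom:
  assumes "f \<in> Hom B X Y" "X \<in> SC" "Y \<in> SC"
  shows "from_quot_mor ZA f \<in> Hom (ext_cat SA B SC) (from_quot ZA X) (from_quot ZA Y)"
  using assms HomD[OF assms(1)] from_quot_Obj[of X] from_quot_Obj[of Y] SA_Obj SC_Obj ZA(1)
    Comp_Ide_left[OF assms(1)] Comp_Ide_right[OF assms(1)] Comp_Zero_right[OF _ assms(1)]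
    Comp_Zero_left[of "Zero B ZA ZA" ZA ZA Y] 
  by (simp add: Hom_ext_cat from_quot_mor_def from_quot_def Ide_ends Zero_ends Zero_in_Hom)

text \<open>A short exact sequence of \<open>SA\<close> becomes itself in the first two terms and
  the constant sequence on \<open>ZC\<close> in the third, exact by \<open>SES_Zero\<close>.\<close>

lemma exact_functor_from_sub:
  "exact_functor (full_subcat B SA) (ext_cat SA B SC) (from_sub ZC) (from_sub_mor ZC)"
  unfolding exact_functor_def
proof (intro conjI ballI allI)
  fix X Y f assume f: "f \<in> Hom (full_subcat B SA) X Y"
  then show "from_sub_mor ZC f \<in> Hom (ext_cat SA B SC) (from_sub ZC X) (from_sub ZC Y)"
    using from_sub_Hom by (simp add: Hom_full_subcat)
next
  fix X Y Z f g assume "f \<in> Hom (full_subcat B SA) X Y" "g \<in> Hom (full_subcat B SA) Y Z"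
  then have fg: "f \<in> Hom B X Y" "g \<in> Hom B Y Z" by (auto simp: Hom_full_subcat)
  show "from_sub_mor ZC (g \<cdot>\<^bsub>full_subcat B SA\<^esub> f) =
      from_sub_mor ZC g \<cdot>\<^bsub>ext_cat SA B SC\<^esub> from_sub_mor ZC f"
    using HomD[OF fg(1)] HomD[OF fg(2)] HomD[OF Comp_in_Hom[OF fg]] ZC(1) SC_Obj
      Comp_Zero_left[OF Zero_in_Hom]
    by (simp add: from_sub_mor_def)
next
  fix ip assume "ip \<in> SES (full_subcat B SA)"
  then obtain i p where ip: "ip = (i, p)" "(i, p) \<in> SES B" "Dom B i \<in> SA" "Cod B i \<in> SA" "Cod B p \<in> SA"
    by auto
  moreover from SES_composable[OF ip(2)] have "i \<in> Arr B" "p \<in> Arr B" "Dom B p = Cod B i" by auto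
  ultimately show "case ip of (i, p) \<Rightarrow> (from_sub_mor ZC i, from_sub_mor ZC p) \<in> SES (ext_cat SA B SC)"
    using from_sub_Hom[of i "Dom B i" "Cod B i"] from_sub_Hom[of p "Dom B p" "Cod B p"]
      SES_Zero(2) ZC(1) SC_Obj
    by (simp add: from_sub_mor_def ext_arrs_iff Zero_ends HomI)
qed (use SA_Obj SC_Obj ZC in
    \<open>simp_all add: from_sub_Obj from_sub_mor_def Ide_ends Zero_ends, simp_all add: from_sub_def Ide_ends Zero_ends\<close>)

lemma exact_functor_from_quot:
  "exact_functor (full_subcat B SC) (ext_cat SA B SC) (from_quot ZA) (from_quot_mor ZA)"
  unfolding exact_functor_def
proof (intro conjI ballI allI)
  fix X Y f assume f: "f \<in> Hom (full_subcat B SC) X Y"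
  then show "from_quot_mor ZA f \<in> Hom (ext_cat SA B SC) (from_quot ZA X) (from_quot ZA Y)"
    using from_quot_Hom by (simp add: Hom_full_subcat)
next
  fix X Y Z f g assume "f \<in> Hom (full_subcat B SC) X Y" "g \<in> Hom (full_subcat B SC) Y Z"
  then have fg: "f \<in> Hom B X Y" "g \<in> Hom B Y Z" by (auto simp: Hom_full_subcat)
  show "from_quot_mor ZA (g \<cdot>\<^bsub>full_subcat B SC\<^esub> f) =
      from_quot_mor ZA g \<cdot>\<^bsub>ext_cat SA B SC\<^esub> from_quot_mor ZA f"
    using HomD[OF fg(1)] HomD[OF fg(2)] HomD[OF Comp_in_Hom[OF fg]] ZA(1) SA_Obj
      Comp_Zero_left[OF Zero_in_Hom]
    by (simp add: from_quot_mor_def)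
next
  fix ip assume "ip \<in> SES (full_subcat B SC)"
  then obtain i p where ip: "ip = (i, p)" "(i, p) \<in> SES B" "Dom B i \<in> SC" "Cod B i \<in> SC" "Cod B p \<in> SC"
    by auto
  moreover from SES_composable[OF ip(2)] have "i \<in> Arr B" "p \<in> Arr B" "Dom B p = Cod B i" by auto
  ultimately show "case ip of (i, p) \<Rightarrow> (from_quot_mor ZA i, from_quot_mor ZA p) \<in> SES (ext_cat SA B SC)"
    using from_quot_Hom[of i "Dom B i" "Cod B i"] from_quot_Hom[of p "Dom B p" "Cod B p"]
      SES_Zero(1) ZA(1) SA_Obj
    by (simp add: from_quot_mor_def ext_arrs_iff Zero_ends HomI)
qed (use SA_Obj SC_Obj ZA in
    \<open>simp_all add: from_quot_Obj from_quot_mor_def Ide_ends Zero_ends, simp_all add: from_quot_def Ide_ends Zero_ends\<close>)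

text \<open>An extension A >-> B ->> C is its own middle row: \<open>\<alpha>\<close> and
  \<open>\<beta>\<close> have the structure maps of X as middle components, so exactness there is
  the exactness of X. The outer rows are the split sequences A = A ->> \<open>ZA\<close> and
  \<open>ZC\<close> >-> C = C.\<close>

lemma natural_ses_ext_cat:
  defines "sub \<equiv> \<lambda>(X, Y, a, b, c). a" and "quot \<equiv> \<lambda>(X, Y, a, b, c). c"
  shows "natural_ses (ext_cat SA B SC) (ext_cat SA B SC)
    (from_sub ZC \<circ> (\<lambda>X. Dom B (fst X))) (from_sub_mor ZC \<circ> sub) id id
    (from_quot ZA \<circ> (\<lambda>X. Cod B (snd X))) (from_quot_mor ZA \<circ> quot)"
proof -
  define \<alpha> where "\<alpha> X = (from_sub ZC (Dom B (fst X)), X,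
    Ide B (Dom B (fst X)), fst X, Zero B ZC (Cod B (snd X)))" for X
  define \<beta> where "\<beta> X = (X, from_quot ZA (Cod B (snd X)),
    Zero B (Dom B (fst X)) ZA, snd X, Ide B (Cod B (snd X)))" for X
  note objD = ext_objsD SA_Obj[OF ext_objsD(3)] SC_Obj[OF ext_objsD(4)]
  have Z: "ZA \<in> Obj B" "ZC \<in> Obj B" using ZA ZC SA_Obj SC_Obj by auto
  have hom: "\<alpha> X \<in> Hom (ext_cat SA B SC) (from_sub ZC (Dom B (fst X))) X"
    "\<beta> X \<in> Hom (ext_cat SA B SC) X (from_quot ZA (Cod B (snd X)))" if X: "X \<in> ext_objs B SA SC" for X
  proof -
    note D = objD[OF X]
    \<comment> \<open>The epimorphism square of \<open>\<alpha> X\<close> passes through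
      \<open>ZC\<close> on one side and is \<open>snd X \<cdot> fst X\<close> on the other, so it
      commutes because that composite is zero. For \<open>\<beta> X\<close> the same happens in the
      monomorphism square, with \<open>ZA\<close>.\<close>
    show "\<alpha> X \<in> Hom (ext_cat SA B SC) (from_sub ZC (Dom B (fst X))) X"
      using X D from_sub_Obj[OF D(3)] Z Comp_Zero_right[OF D(8) Zero_in_Hom[OF Z(2) D(9)]]
      by (simp add: \<alpha>_def Hom_ext_cat) (simp add: from_sub_def Ide_ends Zero_ends Ide_in_Hom Zero_in_Hom)
    show "\<beta> X \<in> Hom (ext_cat SA B SC) X (from_quot ZA (Cod B (snd X)))"
      using X D from_quot_Obj[OF D(4)] Z Comp_Zero_right[OF D(8) Zero_in_Hom[OF Z(1) D(9)]]
      by (simp add: \<beta>_def Hom_ext_cat) (simp add: from_quot_def Ide_ends Zero_ends Ide_in_Hom Zero_in_Hom)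
  qed
  show ?thesis
    unfolding natural_ses_def
  proof (rule exI[of _ \<alpha>], rule exI[of _ \<beta>], intro conjI ballI allI)
    fix X assume "X \<in> Obj (ext_cat SA B SC)"
    then have X: "X \<in> ext_objs B SA SC" by simp
    note D = objD[OF X]
    show "\<alpha> X \<in> Hom (ext_cat SA B SC) ((from_sub ZC \<circ> (\<lambda>X. Dom B (fst X))) X) (id X)"
      "\<beta> X \<in> Hom (ext_cat SA B SC) (id X) ((from_quot ZA \<circ> (\<lambda>X. Cod B (snd X))) X)"
      using hom[OF X] by simp_all
    show "(\<alpha> X, \<beta> X) \<in> SES (ext_cat SA B SC)"
      using hom[OF X] SES_Ide_Zero(1)[OF D(8) Z(1) ZA(2)] SES_Ide_Zero(2)[OF D(9) Z(2) ZC(2)] D Z ZA(1) ZC(1)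
      by (simp add: \<alpha>_def \<beta>_def ext_arrs_iff Ide_ends Zero_ends)
  next
    fix X Y f assume f: "f \<in> Hom (ext_cat SA B SC) X Y"
    then obtain a b c where f: "f = (X, Y, a, b, c)" and X: "X \<in> ext_objs B SA SC"
      and Y: "Y \<in> ext_objs B SA SC"
      and abc: "a \<in> Hom B (Dom B (fst X)) (Dom B (fst Y))" "b \<in> Hom B (Cod B (fst X)) (Cod B (fst Y))"
      "c \<in> Hom B (Cod B (snd X)) (Cod B (snd Y))"
      "b \<cdot> fst X = fst Y \<cdot> a" "c \<cdot> snd X = snd Y \<cdot> b"
      unfolding Hom_ext_cat by blast
    note DX = objD[OF X] and DY = objD[OF Y]
    show "\<alpha> Y \<cdot>\<^bsub>ext_cat SA B SC\<^esub> (from_sub_mor ZC \<circ> sub) f = id f \<cdot>\<^bsub>ext_cat SA B SC\<^esub> \<alpha> X"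
      using abc HomD[OF abc(1)] Comp_Ide_left[OF abc(1)] Comp_Ide_right[OF abc(1)]
        Comp_Zero_right[OF Z(2) abc(3)] Comp_Zero_right[OF Z(2) Zero_in_Hom[OF Z(2) DY(9)]]
      by (simp add: f \<alpha>_def sub_def from_sub_mor_def)
    show "\<beta> Y \<cdot>\<^bsub>ext_cat SA B SC\<^esub> id f = (from_quot_mor ZA \<circ> quot) f \<cdot>\<^bsub>ext_cat SA B SC\<^esub> \<beta> X"
      using abc HomD[OF abc(3)] Comp_Ide_left[OF abc(3)] Comp_Ide_right[OF abc(3)]
        Comp_Zero_left[OF abc(1) Z(1)] Comp_Zero_left[OF Zero_in_Hom[OF DX(8) Z(1)] Z(1)]
      by (simp add: f \<beta>_def quot_def from_quot_mor_def)
  qed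
qed

text \<open>All components are the zero endomorphism of Z, which form a short exact sequence when Z
  is a zero object. This kills the cross terms uniformly in n, including n = 0, where there are no
  diagonal relations.\<close>

lemma natural_ses_const:
  assumes Z: "Z \<in> S" "(Zero B Z Z, Zero B Z Z) \<in> SES B" and S: "S \<subseteq> Obj B"
    and F: "\<And>X. X \<in> Obj D \<Longrightarrow> F X = Z" and G: "\<And>f. f \<in> Arr D \<Longrightarrow> G f = Zero B Z Z"
  shows "natural_ses D (full_subcat B S) F G F G F G"
  unfolding natural_ses_def
  using assms Zero_in_Hom[of Z Z] Zero_ends[of Z Z]
  by (intro exI[of _ "\<lambda>_. Zero B Z Z"]) (auto simp: Hom_full_subcat dest: HomD)

lemma K_group_ext_cat_iso:
  "K_group n (ext_cat SA B SC) \<cong> K_group n (full_subcat B SA) \<times>\<times> K_group n (full_subcat B SC)"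
proof (rule K_group_iso_DirProd[OF _ pointed_category_ext_cat _ exact_functor_sub exact_functor_quot
      exact_functor_from_sub exact_functor_from_quot _ _ _ _ _ _ natural_ses_ext_cat])
  show "pointed_category (full_subcat B SA)" "pointed_category (full_subcat B SC)"
    using pointed_category_full_subcat exact_category_axioms SA SC by blast+
  show "Dom B (fst (from_sub ZC X)) = X" if "X \<in> Obj (full_subcat B SA)" for X
    using that SA_Obj by (simp add: from_sub_def Ide_ends)
  show "Cod B (snd (from_quot ZA X)) = X" if "X \<in> Obj (full_subcat B SC)" for X
    using that SC_Obj by (simp add: from_quot_def Ide_ends)
  show "(case from_sub_mor ZC f of (X, Y, a, b, c) \<Rightarrow> a) = f" for f
    by (simp add: from_sub_mor_def)
  show "(case from_quot_mor ZA f of (X, Y, a, b, c) \<Rightarrow> c) = f" for f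
    by (simp add: from_quot_mor_def)
\<comment> \<open>What remains are the cross terms: the quotient of \<open>from_sub ZC X\<close> is
  always \<open>ZC\<close>, and the subobject of \<open>from_quot ZA X\<close> is always
  \<open>ZA\<close>.\<close>
qed (rule natural_ses_const, use ZA ZC SA SC SA_Obj SC_Obj SES_Zero in
    \<open>auto simp: from_sub_def from_sub_mor_def from_quot_def from_quot_mor_def Zero_ends
      exact_subcategory_def\<close>)+

end

end

theorem theorem1p8:
  fixes B :: "('o, 'm) exact_data" and SA SC :: "'o set" and n :: nat
  assumes "exact_category B"
    and "exact_subcategory B SA"
    and "exact_subcategory B SC"
  shows "K_group n (ext_cat SA B SC)
      \<cong> K_group n (full_subcat B SA) \<times>\<times> K_group n (full_subcat B SC)"
proof -
  interpret extension_category B SA SC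
    using assms by (intro extension_category.intro extension_category_axioms.intro)
  obtain ZA where "ZA \<in> SA" "Ide B ZA = Zero B ZA ZA"
    using exact_subcategory_zero assms(1,2) .
  moreover obtain ZC where "ZC \<in> SC" "Ide B ZC = Zero B ZC ZC"
    using exact_subcategory_zero assms(1,3) .
  ultimately show ?thesis by (rule K_group_ext_cat_iso)
qed

end
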